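(* Let $k,q\ge 1$. For every graph $G$ the following are equivalent: (1) $G$ has a $k$-construction tree of elimination depth at most $q$; (2) $G$ has a tree-decomposition of width at most $k-1$ and depth at most $q$; (3) $G$ admits a $k$-pebble forest cover of depth at most $q$.
   Context: All graphs are finite, simple and loopless. A $k$-labelled graph is a graph $G$ with a partial injective-free labelling $\nu_G\colon\{1,\dots,k\}\rightharpoonup V(G)$ (each label on at most one vertex, a vertex may carry several labels, not all labels need be used); it is fully labelled if every vertex carries a label; an unlabelled graph is a $k$-labelled graph with no labels. Removing a label $\ell$ makes $\nu(\ell)$ undefined. The product of two $k$-labelled graphs is obtained from their disjoint union by identifying vertices carrying the same label and suppressing parallel edges. A $k$-construction tree for $G$ is a rooted tree $(T,r)$ with a map $\lambda$ from $V(T)$ to $k$-labelled graphs such that: $\lambda(r)=G$; every leaf is assigned a fully labelled graph; every internal node $t$ with exactly one child $t'$ (an elimination node) has $\lambda(t)$ obtained from $\lambda(t')$ by removing one label; every internal node with more than one child has $\lambda(t)$ equal to the product of the graphs of its children. Its elimination depth is the maximum number of elimination nodes on a root-to-leaf path. A tree-decomposition $(T,\beta)$ of $G$ is a tree $T$ and bags $\beta(t)\subseteq V(G)$ with $\bigcup_t G[\beta(t)]=G$ and, for every vertex $v$, $\{t: v\in\beta(t)\}$ inducing a connected subtree; width is $\max_t|\beta(t)|-1$; depth is $\min_{r\in V(T)}\max_{v\in V(T)}\left|\bigcup_{t\preceq v}\beta(t)\right|$, where $\preceq$ is the ancestor order of $T$ rooted at $r$. A $k$-pebble forest cover of $G$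 is a rooted forest $(F,\vec r)$ on $V(G)$ with induced ancestor order $\preceq$ and a map $p\colon V(G)\to\{1,\dots,k\}$ such that for every edge $uv$, $u\preceq v$ or $v\preceq u$, and if $uv\in E(G)$, $u\prec v$, then $p(u)\ne p(w)$ for all $w$ with $u\prec w\preceq v$; its depth is the maximum number of vertices on a root-to-leaf path. *)

theory Defs
  imports "Graph_Theory.Digraph_Component"
begin

text \<open>
  A finite simple loopless graph is a finite, symmetric, loop-free relation on its vertex set,
  i.e. \<open>pair_graph G\<close>.  Both orientations of an edge belong to \<open>parcs G\<close>, so the
  library predicates \<open>forest\<close> and \<open>tree\<close> are not the undirected notions
  (walking back and forth along an edge is a \<open>cycle\<close> there); an undirected cycle is a
  \<open>cycle\<close> of length at least 3.
\<close>

definition forest_graph :: "'a pair_pre_digraph \<Rightarrow> bool" where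
  "forest_graph F \<longleftrightarrow> pair_graph F \<and>
     \<not> (\<exists>p. pre_digraph.cycle (with_proj F) p \<and> length p \<ge> 3)"

definition tree_graph :: "'a pair_pre_digraph \<Rightarrow> bool" where
  "tree_graph T \<longleftrightarrow> forest_graph T \<and> connected (with_proj T)"

text \<open>The set \<open>R\<close> of roots contains exactly one vertex of every component; a tree rooted
  at \<open>r\<close> is the case \<open>R = {r}\<close>.\<close>

definition rooted_forest :: "'a pair_pre_digraph \<Rightarrow> 'a set \<Rightarrow> bool" where
  "rooted_forest F R \<longleftrightarrow> forest_graph F \<and> R \<subseteq> pverts F \<and>
     (\<forall>v\<in>pverts F. \<exists>!r. r \<in> R \<and> r \<rightarrow>\<^sup>*\<^bsub>with_proj F\<^esub> v)"

definition rooted_tree :: "'a pair_pre_digraph \<Rightarrow> 'a \<Rightarrow> bool" where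
  "rooted_tree T r \<longleftrightarrow> tree_graph T \<and> r \<in> pverts T"

text \<open>Ancestor order (reflexive): \<open>u\<close> lies on the path from the root to \<open>v\<close>.\<close>

definition anc :: "'a pair_pre_digraph \<Rightarrow> 'a set \<Rightarrow> 'a \<Rightarrow> 'a \<Rightarrow> bool" where
  "anc F R u v \<longleftrightarrow>
     (\<exists>r\<in>R. \<exists>p. pre_digraph.apath (with_proj F) r p v \<and> u \<in> set (pawalk_verts r p))"

definition sanc :: "'a pair_pre_digraph \<Rightarrow> 'a set \<Rightarrow> 'a \<Rightarrow> 'a \<Rightarrow> bool" where
  "sanc F R u v \<longleftrightarrow> anc F R u v \<and> u \<noteq> v"

definition children :: "'a pair_pre_digraph \<Rightarrow> 'a set \<Rightarrow> 'a \<Rightarrow> 'a set" where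
  "children F R t = {s \<in> pverts F. (t, s) \<in> parcs F \<and> anc F R t s}"

definition leaves :: "'a pair_pre_digraph \<Rightarrow> 'a set \<Rightarrow> 'a set" where
  "leaves F R = {t \<in> pverts F. children F R t = {}}"

text \<open>The vertices on the root-to-leaf path ending in \<open>t\<close> are the ancestors of \<open>t\<close>.
  On \<^typ>\<open>nat\<close> the supremum of a finite nonempty set is its maximum and that of the empty set
  is 0, which is the depth of the empty forest.\<close>

definition forest_depth :: "'a pair_pre_digraph \<Rightarrow> 'a set \<Rightarrow> nat" where
  "forest_depth F R = (SUP t\<in>leaves F R. card {s. anc F R s t})"


record 'a labelled_graph =
  graph_of :: "'a pair_pre_digraph"
  labelling :: "nat \<rightharpoonup> 'a"

definition k_labelled :: "nat \<Rightarrow> 'a labelled_graph \<Rightarrow> bool" where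
  "k_labelled k L \<longleftrightarrow> pair_graph (graph_of L) \<and> dom (labelling L) \<subseteq> {1..k} \<and>
     ran (labelling L) \<subseteq> pverts (graph_of L)"

definition fully_labelled :: "'a labelled_graph \<Rightarrow> bool" where
  "fully_labelled L \<longleftrightarrow> pverts (graph_of L) \<subseteq> ran (labelling L)"

definition unlabelled :: "'a pair_pre_digraph \<Rightarrow> 'a labelled_graph" where
  "unlabelled G = \<lparr>graph_of = G, labelling = Map.empty\<rparr>"

definition remove_label :: "nat \<Rightarrow> 'a labelled_graph \<Rightarrow> 'a labelled_graph" where
  "remove_label l L = L\<lparr>labelling := (labelling L)(l := None)\<rparr>"

definition labelled_iso :: "'a labelled_graph \<Rightarrow> 'b labelled_graph \<Rightarrow> bool" where
  "labelled_iso L M \<longleftrightarrow> (\<exists>f. bij_betw f (pverts (graph_of L)) (pverts (graph_of M)) \<and>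
     parcs (graph_of M) = map_prod f f ` parcs (graph_of L) \<and>
     labelling M = (\<lambda>l. map_option f (labelling L l)))"

text \<open>
  Product of a family of labelled graphs, as a quotient of the disjoint union.
  Since a vertex may carry several labels, identifying vertices with a common label can force
  further identifications, whence the equivalence closure (\<open>glue\<close> is symmetric).
  Parallel edges disappear because edges form a set.  If two adjacent vertices get identified,
  the result has a loop and hence is not \<open>k_labelled\<close>.
\<close>

definition glue :: "'i set \<Rightarrow> ('i \<Rightarrow> 'a labelled_graph) \<Rightarrow> ('i \<times> 'a) rel" where
  "glue I L = {((i, u), (j, v)) | i u j v. i \<in> I \<and> j \<in> I \<and>
     (\<exists>l. labelling (L i) l = Some u \<and> labelling (L j) l = Some v)}"

definition glue_class :: "'i set \<Rightarrow> ('i \<Rightarrow> 'a labelled_graph) \<Rightarrow> 'i \<Rightarrow> 'a \<Rightarrow> ('i \<times> 'a) set" where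
  "glue_class I L i u = (glue I L)\<^sup>* `` {(i, u)}"

definition labelled_product ::
  "'i set \<Rightarrow> ('i \<Rightarrow> 'a labelled_graph) \<Rightarrow> ('i \<times> 'a) set labelled_graph" where
  "labelled_product I L =
     \<lparr>graph_of =
        \<lparr>pverts = {glue_class I L i u | i u. i \<in> I \<and> u \<in> pverts (graph_of (L i))},
         parcs = {(glue_class I L i u, glue_class I L i v) | i u v.
                    i \<in> I \<and> (u, v) \<in> parcs (graph_of (L i))}\<rparr>,
      labelling = (\<lambda>l. if \<exists>i\<in>I. l \<in> dom (labelling (L i))
        then Some (THE c. \<exists>i\<in>I. \<exists>u. labelling (L i) l = Some u \<and> c = glue_class I L i u)
        else None)\<rparr>"

text \<open>Equality of labelled graphs is read up to label-preserving isomorphism.\<close>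

definition construction_tree ::
  "nat \<Rightarrow> 'a labelled_graph \<Rightarrow> 't pair_pre_digraph \<Rightarrow> 't \<Rightarrow> ('t \<Rightarrow> 'b labelled_graph) \<Rightarrow> bool" where
  "construction_tree k G T r \<Lambda> \<longleftrightarrow>
     rooted_tree T r \<and> (\<forall>t\<in>pverts T. k_labelled k (\<Lambda> t)) \<and>
     labelled_iso (\<Lambda> r) G \<and>
     (\<forall>t\<in>leaves T {r}. fully_labelled (\<Lambda> t)) \<and>
     (\<forall>t\<in>pverts T. \<forall>t'. children T {r} t = {t'} \<longrightarrow>
        (\<exists>l\<in>dom (labelling (\<Lambda> t')). labelled_iso (\<Lambda> t) (remove_label l (\<Lambda> t')))) \<and>
     (\<forall>t\<in>pverts T. card (children T {r} t) > 1 \<longrightarrow>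
        labelled_iso (\<Lambda> t) (labelled_product (children T {r} t) \<Lambda>))"

definition elimination_nodes :: "'t pair_pre_digraph \<Rightarrow> 't \<Rightarrow> 't set" where
  "elimination_nodes T r = {t \<in> pverts T. card (children T {r} t) = 1}"

definition elimination_depth :: "'t pair_pre_digraph \<Rightarrow> 't \<Rightarrow> nat" where
  "elimination_depth T r =
     (MAX t\<in>leaves T {r}. card {s \<in> elimination_nodes T r. anc T {r} s t})"


definition tree_decomposition ::
  "'a pair_pre_digraph \<Rightarrow> 't pair_pre_digraph \<Rightarrow> ('t \<Rightarrow> 'a set) \<Rightarrow> bool" where
  "tree_decomposition G T \<beta> \<longleftrightarrow>
     tree_graph T \<and> (\<forall>t\<in>pverts T. \<beta> t \<subseteq> pverts G) \<and>
     pre_digraph.Union (with_proj G) ((\<lambda>t. with_proj G \<restriction> \<beta> t) ` pverts T) = with_proj G \<and>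
     (\<forall>v\<in>pverts G. connected (with_proj T \<restriction> {t \<in> pverts T. v \<in> \<beta> t}))"

text \<open>An integer, since the empty graph has a decomposition of width \<open>-1\<close>.\<close>

definition td_width :: "'t pair_pre_digraph \<Rightarrow> ('t \<Rightarrow> 'a set) \<Rightarrow> int" where
  "td_width T \<beta> = int (MAX t\<in>pverts T. card (\<beta> t)) - 1"

definition td_depth :: "'t pair_pre_digraph \<Rightarrow> ('t \<Rightarrow> 'a set) \<Rightarrow> nat" where
  "td_depth T \<beta> =
     (MIN r\<in>pverts T. MAX v\<in>pverts T. card (\<Union>t\<in>{t. anc T {r} t v}. \<beta> t))"


definition pebble_forest_cover ::
  "nat \<Rightarrow> 'a pair_pre_digraph \<Rightarrow> 'a pair_pre_digraph \<Rightarrow> 'a set \<Rightarrow> ('a \<Rightarrow> nat) \<Rightarrow> bool" where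
  "pebble_forest_cover k G F R p \<longleftrightarrow>
     rooted_forest F R \<and> pverts F = pverts G \<and> p ` pverts G \<subseteq> {1..k} \<and>
     (\<forall>u v. (u, v) \<in> parcs G \<longrightarrow> anc F R u v \<or> anc F R v u) \<and>
     (\<forall>u v. (u, v) \<in> parcs G \<and> sanc F R u v \<longrightarrow>
        (\<forall>w. sanc F R u w \<and> anc F R w v \<longrightarrow> p u \<noteq> p w))"

end

theory Submission
  imports Defs
begin

text \<open>
  Rooted forests are handled through their parent relation: in a forest the arcs that increase the
  distance to the roots point from the unique parent to the child, and the ancestor order is the
  reflexive-transitive closure of this relation.

  (1) to (2): follow the vertices of every labelled graph of a construction tree up to the root and
  take as bags the images of the labelled vertices. Going down one step, only an elimination node
  can add a vertex to the bag, and it adds at most one. An unlabelled vertex is never identified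
  with another one further up, which makes the bags containing a given vertex connected.

  (2) to (3): order the vertices by their topmost bag, breaking ties arbitrarily, and colour them
  greedily from the root down, avoiding the colours of the smaller vertices in the topmost bag.

  (3) to (1): for a vertex \<open>v\<close> of the forest let \<open>S v\<close> be the ancestors of \<open>v\<close> whose pebble
  has not been moved on the way down to \<open>v\<close>. The graph induced on \<open>S v\<close> and the descendants of
  \<open>v\<close>, with \<open>S v\<close> labelled by its pebbles, is the product of the graph induced on \<open>S v\<close> and of
  the corresponding graphs of the children \<open>w\<close> of \<open>v\<close> with the label of \<open>w\<close> removed.
\<close>

section \<open>Rooted forests as parent relations\<close>

text \<open>The obstacle in (1) to (2) is that labelled vertices may be merged further up: a graph
  of the construction tree need not embed in \<open>G\<close>, and following vertices up is
  injective only over unlabelled ones. So each vertex of \<open>G\<close> is tracked through the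
  nodes where its preimage is unlabelled; full labelling of the leaves forces this track to end in a
  bag. The depth bound comes out without loss because the root is unlabelled and has an empty bag,
  so every vertex of the bags met on a path is charged to an elimination node. In (2) to (3) an edge
  keeps its smaller end in every bag between the topmost bag of that end and a bag containing the
  edge. A vertex of the forest between the two ends therefore sees the smaller end among its
  forbidden colours, and fewer than \<open>k\<close> colours are forbidden since the vertex itself
  takes one place in its topmost bag. In (3) to (1) the labels on \<open>S v\<close> suffice because
  an edge leaving the descendants of \<open>v\<close> ends in an ancestor whose pebble, by the
  pebble condition, is still in place.\<close>

lemma rtrancl_on_iff: "(u, v) \<in> rtrancl_on V E \<longleftrightarrow> u \<in> V \<and> (u, v) \<in> (E \<inter> V \<times> V)\<^sup>*"
proof
  assume "(u, v) \<in> rtrancl_on V E"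
  then show "u \<in> V \<and> (u, v) \<in> (E \<inter> V \<times> V)\<^sup>*"
    by (induction) (auto dest: in_rtrancl_on_in_F intro: converse_rtrancl_into_rtrancl)
next
  have "(u, v) \<in> rtrancl_on V E" if "(u, v) \<in> (E \<inter> V \<times> V)\<^sup>*" "u \<in> V"
    using that by (induction) (auto intro: rtrancl_on_into_rtrancl_on)
  then show "u \<in> V \<and> (u, v) \<in> (E \<inter> V \<times> V)\<^sup>* \<Longrightarrow> (u, v) \<in> rtrancl_on V E" by blast
qed

lemma rtrancl_converse_subset:
  assumes "(u, v) \<in> E\<^sup>*" "E\<inverse> \<subseteq> E"
  shows "(v, u) \<in> E\<^sup>*"
  by (metis assms converse_iff in_mono rtrancl_converse rtrancl_mono)

lemma (in pair_wf_digraph) reachable_iff_rtrancl: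
  "u \<rightarrow>\<^sup>*\<^bsub>with_proj G\<^esub> v \<longleftrightarrow> u \<in> pverts G \<and> (u, v) \<in> (parcs G)\<^sup>*"
proof -
  have "parcs G \<inter> pverts G \<times> pverts G = parcs G"
    using in_arcsD1 in_arcsD2 by auto
  then show ?thesis by (simp add: reachable_def rtrancl_on_iff)
qed

text \<open>\<open>connected\<close> is strong connectivity of the symmetric closure. Here every arc
  has a reverse and both ends in the graph, so neither the closure nor the restriction to the vertex
  set changes the arc relation.\<close>

lemma connected_symmetric_iff:
  assumes "verts H \<noteq> {}" "\<And>e. e \<in> arcs H \<Longrightarrow> (head H e, tail H e) \<in> arcs_ends H"
    and "\<And>e. e \<in> arcs H \<Longrightarrow> head H e \<in> verts H \<and> tail H e \<in> verts H"
  shows "connected H \<longleftrightarrow> (\<forall>u\<in>verts H. \<forall>v\<in>verts H. (u, v) \<in> (arcs_ends H)\<^sup>*)"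
proof -
  have eq: "parcs (mk_symmetric H) = arcs_ends H"
    using assms(2) by (auto simp: parcs_mk_symmetric arcs_ends_def arc_to_ends_def)
  have "arcs_ends H \<inter> verts H \<times> verts H = arcs_ends H"
    using assms(3) by (auto simp: arcs_ends_def arc_to_ends_def)
  then show ?thesis using assms(1) eq
    by (simp add: connected_def strongly_connected_def reachable_def rtrancl_on_iff)
qed

text \<open>Taking indices modulo the length makes the closing arc of a closed walk an ordinary
  step, so every vertex of a cycle has a predecessor and a successor.\<close>

lemma awalk_cyclic_successor:
  fixes p :: "('b \<times> 'b) list"
  assumes "pcas u p v" "u = v" "i < length p"
  shows "fst (p ! (Suc i mod length p)) = snd (p ! i)"
proof -
  have first: "fst (p ! 0) = u" if "pcas u p v" "p \<noteq> []" for u v and p :: "('b \<times> 'b) list"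
    using that by (cases p) auto
  have last: "snd (last p) = v" if "pcas u p v" "p \<noteq> []" for u v and p :: "('b \<times> 'b) list"
    using that by (induction p arbitrary: u) auto
  have next_arc: "fst (p ! Suc i) = snd (p ! i)" if "pcas u p v" "Suc i < length p"
    for u v and p :: "('b \<times> 'b) list" and i
    using that
  proof (induction p arbitrary: u i)
    case (Cons a p)
    then show ?case using first[of "snd a" p] by (cases i) auto
  qed simp
  show ?thesis
  proof (cases "Suc i = length p")
    case True
    then show ?thesis using assms first[of u p] last[of u p]
      by (metis diff_Suc_1 last_conv_nth length_0_conv mod_self nat.distinct(1))
  next
    case False
    then show ?thesis using assms next_arc by simp
  qed
qed

text \<open>A pair \<open>(u, v)\<close> in \<open>P\<close> means that \<open>u\<close> is the
  parent of \<open>v\<close>. Finiteness and acyclicity make \<open>P\<close> and its converse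
  well-founded, which permits induction from the roots down and from the leaves up.\<close>

locale branching =
  fixes V :: "'a set" and P :: "'a rel"
  assumes finite_V: "finite V"
    and P_subset: "P \<subseteq> V \<times> V"
    and parent_unique: "(u, v) \<in> P \<Longrightarrow> (u', v) \<in> P \<Longrightarrow> u = u'"
    and acyclic_P: "acyclic P"

definition branching_graph :: "'a set \<Rightarrow> 'a rel \<Rightarrow> 'a pair_pre_digraph" where
  "branching_graph V P = \<lparr>pverts = V, parcs = P \<union> P\<inverse>\<rparr>"

definition tops :: "'a set \<Rightarrow> 'a rel \<Rightarrow> 'a set" where
  "tops V P = {v \<in> V. \<forall>u. (u, v) \<notin> P}"

lemma branching_graph_simps [simp]:
  "pverts (branching_graph V P) = V"
  "parcs (branching_graph V P) = P \<union> P\<inverse>"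
  by (simp_all add: branching_graph_def)

lemma acyclic_rank:
  fixes f :: "'a \<Rightarrow> nat"
  assumes "\<And>u v. (u, v) \<in> P \<Longrightarrow> f u < f v"
  shows "acyclic P"
proof -
  have "f u < f v" if "(u, v) \<in> P\<^sup>+" for u v
    using that by (induction) (auto dest: assms intro: less_trans)
  then show ?thesis unfolding acyclic_def by blast
qed

context branching
begin

lemma in_V: "(u, v) \<in> P \<Longrightarrow> u \<in> V" "(u, v) \<in> P \<Longrightarrow> v \<in> V"
  using P_subset by auto

lemma rtrancl_in_V: "(u, v) \<in> P\<^sup>* \<Longrightarrow> v \<in> V \<Longrightarrow> u \<in> V"
  by (induction rule: converse_rtrancl_induct) (auto dest: in_V)

lemma rtrancl_in_V': "(u, v) \<in> P\<^sup>* \<Longrightarrow> u \<in> V \<Longrightarrow> v \<in> V"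
  by (induction rule: rtrancl_induct) (auto dest: in_V)

lemma finite_P: "finite P"
  using finite_V P_subset by (auto intro: finite_subset)

lemma wf_P: "wf P"
  using finite_P acyclic_P by (rule finite_acyclic_wf)

lemma wf_converse: "wf (P\<inverse>)"
  using finite_P acyclic_P by (rule finite_acyclic_wf_converse)

lemma antisym: "(u, v) \<in> P\<^sup>* \<Longrightarrow> (v, u) \<in> P\<^sup>* \<Longrightarrow> u = v"
  using acyclic_impl_antisym_rtrancl[OF acyclic_P] by (auto dest: antisymD)

lemma no_back: "(u, v) \<in> P \<Longrightarrow> (v, u) \<notin> P\<^sup>*"
  using acyclic_P by (meson acyclic_def rtrancl_into_trancl2)

lemma irrefl: "(u, u) \<notin> P"
  using no_back by blast

lemma ancestor_step:
  assumes "(x, v) \<in> P\<^sup>*" "(u, v) \<in> P"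
  shows "x = v \<or> (x, u) \<in> P\<^sup>*"
  using assms(1)
proof (cases rule: rtrancl.cases)
  case (rtrancl_into_rtrancl b)
  then show ?thesis using parent_unique assms(2) by blast
qed simp

lemma ancestors_comparable:
  assumes "(x, v) \<in> P\<^sup>*" "(y, v) \<in> P\<^sup>*"
  shows "(x, y) \<in> P\<^sup>* \<or> (y, x) \<in> P\<^sup>*"
  using assms
proof (induction rule: rtrancl_induct)
  case (step u v)
  then show ?case using ancestor_step[of y v u] by (auto intro: rtrancl_into_rtrancl)
qed simp

lemma finite_ancestors: "finite {u. (u, v) \<in> P\<^sup>*}"
proof -
  have "{u. (u, v) \<in> P\<^sup>*} \<subseteq> insert v V"
    by (auto elim: converse_rtranclE dest: in_V)
  then show ?thesis using finite_V finite_subset by blast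
qed

text \<open>\<open>v\<close> counts itself, so a root has level 1. This is the number that the depth
  of a forest cover bounds.\<close>

definition level :: "'a \<Rightarrow> nat" where
  "level v = card {u. (u, v) \<in> P\<^sup>*}"

lemma ancestors_step: "(u, v) \<in> P \<Longrightarrow> {x. (x, v) \<in> P\<^sup>*} = insert v {x. (x, u) \<in> P\<^sup>*}"
  using ancestor_step by (auto intro: rtrancl_into_rtrancl)

lemma level_step: "(u, v) \<in> P \<Longrightarrow> level v = Suc (level u)"
  using no_back by (simp add: level_def ancestors_step finite_ancestors)

lemma level_rtrancl: "(u, v) \<in> P\<^sup>* \<Longrightarrow> level u \<le> level v"
  by (induction rule: rtrancl_induct) (auto dest: level_step)

lemma top_above: "v \<in> V \<Longrightarrow> \<exists>r\<in>tops V P. (r, v) \<in> P\<^sup>*"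
proof (induction v rule: wf_induct_rule[OF wf_P])
  case (1 v)
  show ?case
  proof (cases "v \<in> tops V P")
    case False
    then obtain u where "(u, v) \<in> P" using 1 by (auto simp: tops_def)
    then show ?thesis using 1 in_V by (meson rtrancl_into_rtrancl)
  qed blast
qed

lemma top_ancestor: "r \<in> tops V P \<Longrightarrow> (u, r) \<in> P\<^sup>* \<Longrightarrow> u = r"
  by (auto simp: tops_def elim: rtranclE)

lemma top_unique: "r \<in> tops V P \<Longrightarrow> s \<in> tops V P \<Longrightarrow> (r, v) \<in> P\<^sup>* \<Longrightarrow> (s, v) \<in> P\<^sup>* \<Longrightarrow> r = s"
  using ancestors_comparable top_ancestor by metis

lemma minimal_below: "\<exists>t. (v, t) \<in> P\<^sup>* \<and> (\<forall>s. (t, s) \<notin> P)"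
proof (induction v rule: wf_induct_rule[OF wf_converse])
  case (1 v)
  then show ?case
    by (metis converse_iff converse_rtrancl_into_rtrancl rtrancl.rtrancl_refl)
qed

lemma pair_graph_branching_graph: "pair_graph (branching_graph V P)"
  using finite_V finite_P irrefl
  by unfold_locales (auto dest: in_V simp: symmetric_def sym_def)

sublocale bg: pair_graph "branching_graph V P"
  by (rule pair_graph_branching_graph)

text \<open>At a vertex of maximal level on a cycle both cycle neighbours are its parent. Hence they
  coincide, which distinctness forbids for length at least 3.\<close>

lemma forest_branching_graph: "forest_graph (branching_graph V P)"
  unfolding forest_graph_def
proof (intro conjI notI pair_graph_branching_graph, elim exE conjE)
  fix p
  assume cyc: "pre_digraph.cycle (with_proj (branching_graph V P)) p" and len: "length p \<ge> 3"
  define n where "n = length p"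
  obtain u where u: "bg.awalk u p u" "distinct (tl (bg.awalk_verts u p))" "p \<noteq> []"
    using cyc by (auto simp: bg.cycle_def)
  have pcas: "pcas u p u" and arcs: "set p \<subseteq> P \<union> P\<inverse>"
    using u(1) by (auto simp: bg.awalk_def)
  have verts: "tl (bg.awalk_verts u p) = map snd p" if "pcas u p v" for u v
    using that by (induction p arbitrary: u) (auto, case_tac p, auto)
  have "distinct (map snd p)" using u(2) verts[OF pcas] by simp
  then have inj: "i = j" if "i < n" "j < n" "snd (p ! i) = snd (p ! j)" for i j
    using that by (auto simp: distinct_conv_nth n_def)
  obtain i where i: "i < n" and max: "\<And>j. j < n \<Longrightarrow> level (snd (p ! j)) \<le> level (snd (p ! i))"
  proof -
    have "Max ((\<lambda>j. level (snd (p ! j))) ` {..<n}) \<in> (\<lambda>j. level (snd (p ! j))) ` {..<n}"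
      using len by (intro Max_in) (auto simp: n_def lessThan_empty_iff)
    then obtain i where "i < n" "level (snd (p ! i)) = Max ((\<lambda>j. level (snd (p ! j))) ` {..<n})"
      by auto
    then show thesis by (intro that[of i]) auto
  qed
  define v where "v = snd (p ! i)"
  \<comment> \<open>\<open>j\<close> and \<open>h\<close> are the cyclic successor and predecessor
    of position \<open>i\<close>; the length bound separates them.\<close>
  define j where "j = Suc i mod n"
  define h where "h = (if i = 0 then n - 1 else i - 1)"
  have jh: "j < n" "h < n" "j \<noteq> h" "Suc h mod n = i"
    using i len by (auto simp: j_def h_def n_def mod_Suc)
  have arc: "(x, y) \<in> P" if "(x, y) \<in> set p \<or> (y, x) \<in> set p" "level x \<le> level y" for x y
    using that arcs level_step[of y x] by auto
  have next_arc: "fst (p ! (Suc m mod n)) = snd (p ! m)" if "m < n" for m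
    using awalk_cyclic_successor[OF pcas refl] that by (simp add: n_def)
  have "p ! i = (snd (p ! h), v)"
    using next_arc[of h] jh by (simp add: v_def prod_eq_iff)
  then have "(snd (p ! h), v) \<in> P"
    using arc[of "snd (p ! h)" v] max[of h] i jh nth_mem[of i p] by (auto simp: v_def n_def)
  moreover have "p ! j = (v, snd (p ! j))"
    using next_arc[OF i] by (simp add: v_def j_def prod_eq_iff)
  then have "(snd (p ! j), v) \<in> P"
    using arc[of "snd (p ! j)" v] max[of j] jh nth_mem[of j p] by (auto simp: v_def n_def)
  ultimately show False
    using parent_unique inj jh by blast
qed

text \<open>Climbing from \<open>x\<close> to its parent cannot leave the descendants of
  \<open>r\<close>: having a parent, \<open>x\<close> differs from the root
  \<open>r\<close>.\<close>

lemma same_top: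
  assumes "(u, v) \<in> (P \<union> P\<inverse>)\<^sup>*" "r \<in> tops V P" "(r, u) \<in> P\<^sup>*"
  shows "(r, v) \<in> P\<^sup>*"
  using assms(1)
proof (induction rule: rtrancl_induct)
  case (step x y)
  show ?case
  proof (cases "(x, y) \<in> P")
    case True
    then show ?thesis using step by auto
  next
    case False
    then have "(y, x) \<in> P" using step by auto
    then show ?thesis using step ancestor_step[of r x y] assms(2) by (auto simp: tops_def)
  qed
qed (fact assms(3))

lemma rtrancl_symcl: "(u, v) \<in> P\<^sup>* \<Longrightarrow> (u, v) \<in> (P \<union> P\<inverse>)\<^sup>*"
  using rtrancl_mono[of P "P \<union> P\<inverse>"] by auto

lemma rooted_forest_branching_graph: "rooted_forest (branching_graph V P) (tops V P)"
  unfolding rooted_forest_def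
proof (intro conjI ballI forest_branching_graph)
  fix v assume "v \<in> pverts (branching_graph V P)"
  then obtain r where r: "r \<in> tops V P" "(r, v) \<in> P\<^sup>*" using top_above by auto
  show "\<exists>!r. r \<in> tops V P \<and> r \<rightarrow>\<^sup>*\<^bsub>with_proj (branching_graph V P)\<^esub> v"
  proof (rule ex1I[of _ r])
    show "r \<in> tops V P \<and> r \<rightarrow>\<^sup>*\<^bsub>with_proj (branching_graph V P)\<^esub> v"
      using r by (auto simp: bg.reachable_iff_rtrancl rtrancl_symcl tops_def)
  next
    fix s assume "s \<in> tops V P \<and> s \<rightarrow>\<^sup>*\<^bsub>with_proj (branching_graph V P)\<^esub> v"
    then show "s = r"
      using r top_unique same_top[of s v s] by (auto simp: bg.reachable_iff_rtrancl)
  qed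
qed (auto simp: tops_def)

text \<open>A simple path from a root never climbs: when it stands at \<open>a\<close> it has
  already visited every ancestor of \<open>a\<close>, so the next new vertex is a child.\<close>

lemma apath_verts:
  assumes "r \<in> tops V P"
  shows "bg.apath r p v \<Longrightarrow> set (pawalk_verts r p) = {x. (x, v) \<in> P\<^sup>*}"
proof (induction p arbitrary: v rule: rev_induct)
  case Nil
  then show ?case using top_ancestor[OF assms] by (auto simp: bg.apath_def bg.awalk_def)
next
  case (snoc e p)
  obtain a b where e: "e = (a, b)" by force
  have bv: "b = v" and ap: "bg.apath r p a" and arc: "(a, b) \<in> P \<union> P\<inverse>"
    and new: "b \<notin> set (pawalk_verts r p)"
    and vs: "pawalk_verts r (p @ [e]) = pawalk_verts r p @ [b]"
  proof -
    have aw: "bg.awalk r (p @ [e]) v" and dis: "distinct (pawalk_verts r (p @ [e]))"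
      using snoc.prems by (auto simp: bg.apath_def)
    have a: "bg.awalk r p a" using aw by (auto simp: bg.awalk_simps e)
    then have la: "bg.awlast r p = a" by auto
    show "b = v" "(a, b) \<in> P \<union> P\<inverse>" using aw by (auto simp: bg.awalk_simps e)
    show vs: "pawalk_verts r (p @ [e]) = pawalk_verts r p @ [b]"
      using bg.awalk_verts_append[OF aw] la by (simp add: e)
    show "b \<notin> set (pawalk_verts r p)" "bg.apath r p a"
      using dis a by (auto simp: vs bg.apath_def)
  qed
  have IH: "set (pawalk_verts r p) = {x. (x, a) \<in> P\<^sup>*}" using snoc.IH[OF ap] .
  with arc new have "(a, b) \<in> P" by auto
  then show ?case using IH vs bv ancestors_step[of a b] by simp
qed

lemma apath_exists:
  assumes "r \<in> tops V P" "(r, v) \<in> P\<^sup>*"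
  shows "\<exists>p. bg.apath r p v"
  using assms(2)
proof (induction rule: rtrancl_induct)
  case base
  then show ?case using assms(1) by (intro exI[of _ "[]"]) (auto simp: bg.apath_def bg.awalk_def tops_def)
next
  case (step u v)
  then obtain p where p: "bg.apath r p u" by blast
  then have "bg.awlast r p = u" by (auto simp: bg.apath_def)
  moreover have "v \<notin> set (pawalk_verts r p)"
    using apath_verts[OF assms(1) p] no_back step by auto
  ultimately have "bg.apath r (p @ [(u, v)]) v"
    using p step in_V irrefl by (auto simp: bg.apath_append_iff bg.apath_simps)
  then show ?case by blast
qed

lemma anc_iff: "anc (branching_graph V P) (tops V P) u v \<longleftrightarrow> v \<in> V \<and> (u, v) \<in> P\<^sup>*"
proof
  assume "anc (branching_graph V P) (tops V P) u v"
  then obtain r p where r: "r \<in> tops V P" and p: "bg.apath r p v" "u \<in> set (pawalk_verts r p)"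
    by (auto simp: anc_def)
  then have "v \<in> V" by (auto simp: bg.apath_def dest: bg.awalk_last_in_verts)
  then show "v \<in> V \<and> (u, v) \<in> P\<^sup>*" using apath_verts[OF r p(1)] p(2) by auto
next
  assume v: "v \<in> V \<and> (u, v) \<in> P\<^sup>*"
  then obtain r where r: "r \<in> tops V P" "(r, v) \<in> P\<^sup>*" using top_above by auto
  then obtain p where "bg.apath r p v" using apath_exists by blast
  then show "anc (branching_graph V P) (tops V P) u v"
    using r v apath_verts unfolding anc_def by blast
qed

lemma sanc_iff: "sanc (branching_graph V P) (tops V P) u v \<longleftrightarrow> v \<in> V \<and> (u, v) \<in> P\<^sup>* \<and> u \<noteq> v"
  by (auto simp: sanc_def anc_iff)

lemma children_eq: "children (branching_graph V P) (tops V P) t = {s. (t, s) \<in> P}"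
  using no_back in_V by (fastforce simp: children_def anc_iff)

lemma leaves_eq: "leaves (branching_graph V P) (tops V P) = {t \<in> V. \<forall>s. (t, s) \<notin> P}"
  by (auto simp: leaves_def children_eq)

text \<open>The number of ancestors grows downwards, so leaves attain the maximum. The empty forest
  is treated apart, since its supremum is not a \<open>Max\<close>.\<close>

lemma forest_depth_le_iff:
  "forest_depth (branching_graph V P) (tops V P) \<le> q \<longleftrightarrow> (\<forall>v\<in>V. card {u. (u, v) \<in> P\<^sup>*} \<le> q)"
proof -
  let ?L = "leaves (branching_graph V P) (tops V P)"
  have fin: "finite ?L" using finite_V by (simp add: leaves_eq)
  have eq: "{s. anc (branching_graph V P) (tops V P) s t} = {u. (u, t) \<in> P\<^sup>*}" if "t \<in> ?L" for t
    using that by (auto simp: anc_iff leaves_eq)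
  have "forest_depth (branching_graph V P) (tops V P) \<le> q \<longleftrightarrow> (\<forall>t\<in>?L. card {u. (u, t) \<in> P\<^sup>*} \<le> q)"
  proof (cases "?L = {}")
    case False
    then have "forest_depth (branching_graph V P) (tops V P) \<le> q \<longleftrightarrow>
      (\<forall>t\<in>?L. card {s. anc (branching_graph V P) (tops V P) s t} \<le> q)"
      unfolding forest_depth_def using fin by (subst cSup_eq_Max) auto
    then show ?thesis by (simp add: eq)
  qed (simp add: forest_depth_def)
  moreover have "\<exists>t\<in>?L. card {u. (u, v) \<in> P\<^sup>*} \<le> card {u. (u, t) \<in> P\<^sup>*}" if "v \<in> V" for v
  proof -
    obtain t where t: "(v, t) \<in> P\<^sup>*" "\<forall>s. (t, s) \<notin> P" using minimal_below by blast
    then show ?thesis using that rtrancl_in_V' level_rtrancl[OF t(1)]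
      by (intro bexI[of _ t]) (auto simp: leaves_eq level_def)
  qed
  ultimately show ?thesis by (auto simp: leaves_eq) (meson le_trans)
qed

lemma rooted_tree_branching_graph:
  assumes "tops V P = {r}"
  shows "rooted_tree (branching_graph V P) r"
proof -
  have r: "r \<in> V" using assms by (auto simp: tops_def)
  have "(r, v) \<in> (P \<union> P\<inverse>)\<^sup>*" if "v \<in> V" for v
    using top_above[OF that] assms rtrancl_symcl by auto
  moreover from this have "(v, r) \<in> (P \<union> P\<inverse>)\<^sup>*" if "v \<in> V" for v
    by (rule rtrancl_converse_subset) (use that in auto)
  ultimately have "connected (with_proj (branching_graph V P))"
    using r in_V by (subst connected_symmetric_iff) (auto intro: rtrancl_trans)
  then show ?thesis
    using r forest_branching_graph by (simp add: rooted_tree_def tree_graph_def)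
qed

end

section \<open>Recovering the parent relation of a rooted forest\<close>

definition root_distance :: "'a pair_pre_digraph \<Rightarrow> 'a set \<Rightarrow> 'a \<Rightarrow> nat" where
  "root_distance F R v = (LEAST n. \<exists>r\<in>R. (r, v) \<in> parcs F ^^ n)"

text \<open>Arcs are oriented by increasing distance to the roots. What must be excluded is a vertex
  with two neighbours that are no farther from the roots: their descents to the common root would
  close a cycle through it.\<close>

lemma rooted_forest_branching:
  assumes "rooted_forest F R"
  obtains P where "branching (pverts F) P" "F = branching_graph (pverts F) P" "R = tops (pverts F) P"
proof -
  define d where "d = root_distance F R"
  define E where "E = parcs F"
  define P where "P = {(u, v) \<in> E. d u < d v}"
  have pg: "pair_graph F" and nocycle: "\<And>p. pre_digraph.cycle (with_proj F) p \<Longrightarrow> length p < 3"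
    and R: "R \<subseteq> pverts F"
    and root: "\<And>v. v \<in> pverts F \<Longrightarrow> \<exists>!r. r \<in> R \<and> r \<rightarrow>\<^sup>*\<^bsub>with_proj F\<^esub> v"
    using assms unfolding rooted_forest_def forest_graph_def by (auto simp: not_le)
  interpret F: pair_graph F by fact
  have sym: "(v, u) \<in> E" if "(u, v) \<in> E" for u v
    using that F.arcs_symmetric by (simp add: E_def)
  then have symE: "E\<inverse> \<subseteq> E" by auto
  have EV: "u \<in> pverts F" "v \<in> pverts F" "u \<noteq> v" if "(u, v) \<in> E" for u v
    using that F.in_arcsD1 F.in_arcsD2 F.no_loops' by (auto simp: E_def)
  have root_unique: "r = s" if "r \<in> R" "s \<in> R" "(r, s) \<in> E\<^sup>*" for r s
  proof -
    have "s \<in> pverts F" using that R by auto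
    then show ?thesis
      using that root[of s] R by (auto simp: F.reachable_iff_rtrancl E_def)
  qed
  have root_steps: "\<exists>n. \<exists>r\<in>R. (r, v) \<in> E ^^ n" if "v \<in> pverts F" for v
    using root[OF that] by (metis F.reachable_iff_rtrancl E_def rtrancl_imp_relpow)
  have d_le: "d v \<le> n" if "r \<in> R" "(r, v) \<in> E ^^ n" for r v n
    unfolding d_def root_distance_def using that by (intro Least_le) (auto simp: E_def)
  have d_witness: "\<exists>r\<in>R. (r, v) \<in> E ^^ d v" if "v \<in> pverts F" for v
    using LeastI_ex[OF root_steps[OF that]] by (simp add: d_def root_distance_def E_def)
  have d_root: "d v = 0 \<longleftrightarrow> v \<in> R" if "v \<in> pverts F" for v
    using d_witness[OF that] d_le[of v v 0] by auto
  have d_pred: "\<exists>u. (u, v) \<in> E \<and> d u = n" if v: "v \<in> pverts F" "d v = Suc n" for v n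
  proof -
    obtain r where r: "r \<in> R" "(r, v) \<in> E ^^ Suc n"
      using d_witness[OF v(1)] v(2) by auto
    then obtain u where u: "(r, u) \<in> E ^^ n" "(u, v) \<in> E" by auto
    obtain s where s: "s \<in> R" "(s, u) \<in> E ^^ d u"
      using d_witness[of u] EV u(2) by blast
    then have "(s, v) \<in> E ^^ Suc (d u)" using u(2) by auto
    then have "d v \<le> Suc (d u)" using d_le s by blast
    then show ?thesis using u d_le[OF r(1) u(1)] v(2) by (intro exI[of _ u]) auto
  qed
  \<comment> \<open>The non-strict inequalities serve twice: for uniqueness of the parent and, in
    \<open>d_neq\<close>, to exclude arcs between vertices at equal distance.\<close>
  have unique: "u = w" if u: "(u, v) \<in> E" "d u \<le> d v" and w: "(w, v) \<in> E" "d w \<le> d v" for u v w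
  proof (rule ccontr)
    assume "u \<noteq> w"
    \<comment> \<open>\<open>H\<close> is the forest without \<open>v\<close>. A descent from
      \<open>y\<close> to the roots stays in \<open>H\<close>: it starts off \<open>v\<close>, no
      farther than \<open>v\<close>, and every step lowers the distance.\<close>
    define H where "H = \<lparr>pverts = pverts F - {v}, parcs = E \<inter> (- {v}) \<times> (- {v})\<rparr>"
    interpret H: pair_wf_digraph H
      by unfold_locales (auto simp: H_def dest: EV)
    have symH: "(parcs H)\<inverse> \<subseteq> parcs H" using sym by (auto simp: H_def)
    have descend: "\<exists>r\<in>R. (y, r) \<in> (parcs H)\<^sup>*"
      if "y \<in> pverts F" "y \<noteq> v" "d y \<le> d v" for y
      using that
    proof (induction "d y" arbitrary: y)
      case 0
      then show ?case using d_root by (intro bexI[of _ y]) auto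
    next
      case (Suc n)
      then obtain x where x: "(x, y) \<in> E" "d x = n" using d_pred[of y n] by metis
      then obtain r where "r \<in> R" "(x, r) \<in> (parcs H)\<^sup>*"
        using Suc EV[of x y] by (metis Suc_leD Suc_n_not_le_n)
      moreover have "(y, x) \<in> parcs H" using x Suc sym[of x y] by (auto simp: H_def)
      ultimately show ?case by (meson converse_rtrancl_into_rtrancl)
    qed
    have HE: "(parcs H)\<^sup>* \<subseteq> E\<^sup>*" by (intro rtrancl_mono) (auto simp: H_def)
    obtain r where r: "r \<in> R" "(u, r) \<in> (parcs H)\<^sup>*" using descend u EV by blast
    obtain s where s: "s \<in> R" "(w, s) \<in> (parcs H)\<^sup>*" using descend w EV by blast
    have "(r, u) \<in> E\<^sup>*" using r(2) rtrancl_converse_subset[OF _ symE] HE by blast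
    also have "(u, w) \<in> E\<^sup>*" using u w sym by (meson r_into_rtrancl rtrancl_trans)
    also have "(w, s) \<in> E\<^sup>*" using s(2) HE by blast
    \<comment> \<open>\<open>R\<close> has one root per component, and \<open>u\<close> and
      \<open>w\<close> are joined through \<open>v\<close>. So the two descents meet and join
      \<open>u\<close> to \<open>w\<close> inside \<open>H\<close>.\<close>
    finally have "r = s" using r s root_unique by blast
    then have "(u, w) \<in> (parcs H)\<^sup>*"
      using r s rtrancl_converse_subset[OF _ symH] by (meson rtrancl_trans)
    then have "u \<rightarrow>\<^sup>*\<^bsub>with_proj H\<^esub> w"
      using EV[OF u(1)] unfolding H.reachable_iff_rtrancl by (simp add: H_def)
    then obtain p where p: "H.apath u p w" using H.reachable_apath by blast
    have p': "H.awalk u p w" "distinct (pawalk_verts u p)"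
      using p by (auto simp: H.apath_def)
    have pF: "F.awalk u p w"
      using p'(1) unfolding H.awalk_def F.awalk_def by (auto simp: H_def E_def)
    have "u \<in> pverts H" "set p \<subseteq> parcs H" using p'(1) unfolding H.awalk_def by blast+
    from H.awalk_verts_in_verts[OF this, of v] have v: "v \<notin> set (pawalk_verts u p)"
      by (auto simp: H_def)
    have "p \<noteq> []" using \<open>u \<noteq> w\<close> p'(1) by (auto simp: H.awalk_def)
    \<comment> \<open>The two arcs at \<open>v\<close> close the path that avoids \<open>v\<close>;
      as this path is nonempty, the cycle has length at least 3.\<close>
    define c where "c = (v, u) # (p @ [(w, v)])"
    have aw: "F.awalk u (p @ [(w, v)]) v"
      using pF w EV by (auto simp: F.awalk_simps E_def)
    then have walk: "F.awalk v c v"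
      using sym[OF u(1)] unfolding c_def F.awalk_Cons_iff by (simp add: E_def)
    moreover have "tl (pawalk_verts v c) = pawalk_verts u p @ [v]"
      using F.awalk_verts_append[OF aw] pF by (auto simp: c_def)
    then have "distinct (tl (pawalk_verts v c))" using p' v by simp
    ultimately have "F.cycle c" by (auto simp: F.cycle_def c_def)
    moreover have "length c \<ge> 3" using \<open>p \<noteq> []\<close> by (cases p) (auto simp: c_def)
    ultimately show False using nocycle[of c] by simp
  qed
  have d_neq: "d u \<noteq> d v" if uv: "(u, v) \<in> E" for u v
  proof
    assume eq: "d u = d v"
    show False
    proof (cases "d v")
      case 0
      then have "u \<in> R" "v \<in> R" using eq d_root[of u] d_root[of v] EV[OF uv] by simp_all
      then show ?thesis using root_unique[of u v] uv EV(3)[OF uv] by auto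
    next
      case (Suc n)
      then obtain w where "(w, v) \<in> E" "d w = n" using d_pred EV(2)[OF uv] by blast
      then show ?thesis using unique[of u v w] uv eq Suc by auto
    qed
  qed
  have P: "branching (pverts F) P"
  proof
    show "finite (pverts F)" using F.pair_finite_verts .
    show "P \<subseteq> pverts F \<times> pverts F" using EV by (auto simp: P_def)
    show "acyclic P" by (rule acyclic_rank[where f = d]) (auto simp: P_def)
  qed (auto simp: P_def intro: unique)
  moreover have "parcs F = P \<union> P\<inverse>"
  proof (intro equalityI subrelI)
    fix u v assume "(u, v) \<in> parcs F"
    then have "(u, v) \<in> E" by (simp add: E_def)
    then show "(u, v) \<in> P \<union> P\<inverse>" using sym[of u v] d_neq[of u v] by (auto simp: P_def)
  next
    fix u v assume "(u, v) \<in> P \<union> P\<inverse>"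
    then show "(u, v) \<in> parcs F" using sym[of v u] by (auto simp: P_def E_def)
  qed
  then have "F = branching_graph (pverts F) P" by (simp add: branching_graph_def)
  moreover have "R = tops (pverts F) P"
  proof -
    have "v \<in> R \<longleftrightarrow> (\<forall>u. (u, v) \<notin> P)" if "v \<in> pverts F" for v
    proof (cases "d v")
      case 0
      then show ?thesis using d_root[OF that] by (auto simp: P_def)
    next
      case (Suc n)
      then show ?thesis using d_pred[OF that Suc] d_root[OF that] by (auto simp: P_def)
    qed
    then show ?thesis using R by (auto simp: tops_def)
  qed
  ultimately show thesis using that by blast
qed

lemma rooted_tree_imp_rooted_forest:
  assumes "rooted_tree T r"
  shows "rooted_forest T {r}"
proof -
  have T: "forest_graph T" "connected (with_proj T)" "r \<in> pverts T"
    using assms by (auto simp: rooted_tree_def tree_graph_def)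
  interpret pair_graph T using T(1) by (simp add: forest_graph_def)
  have "(head (with_proj T) e, tail (with_proj T) e) \<in> arcs_ends (with_proj T)"
    if "e \<in> arcs (with_proj T)" for e
    using that arcs_symmetric[of "fst e" "snd e"] by simp
  moreover have "head (with_proj T) e \<in> verts (with_proj T) \<and> tail (with_proj T) e \<in> verts (with_proj T)"
    if "e \<in> arcs (with_proj T)" for e
    using that in_arcsD1[of "fst e" "snd e"] in_arcsD2[of "fst e" "snd e"] by simp
  ultimately have "\<forall>u\<in>verts (with_proj T). \<forall>v\<in>verts (with_proj T). (u, v) \<in> (arcs_ends (with_proj T))\<^sup>*"
    using connected_symmetric_iff[of "with_proj T"] T(2,3) by force
  then have "r \<rightarrow>\<^sup>*\<^bsub>with_proj T\<^esub> v" if "v \<in> pverts T" for v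
    using that T(3) by (simp add: reachable_iff_rtrancl)
  then show ?thesis using T by (auto simp: rooted_forest_def)
qed

lemma rooted_tree_branching:
  assumes "rooted_tree T r"
  obtains P where "branching (pverts T) P" "T = branching_graph (pverts T) P" "tops (pverts T) P = {r}"
  using rooted_forest_branching[OF rooted_tree_imp_rooted_forest[OF assms]] by metis

section \<open>Forest covers and tree decompositions on parent relations\<close>

text \<open>In the last conjunct the chain from \<open>u\<close> through \<open>w\<close> to
  \<open>v\<close> encodes that \<open>u\<close> is a proper ancestor of \<open>v\<close>.\<close>

definition pebbling :: "nat \<Rightarrow> 'a set \<Rightarrow> 'a rel \<Rightarrow> 'a rel \<Rightarrow> ('a \<Rightarrow> nat) \<Rightarrow> bool" where
  "pebbling k V E P p \<longleftrightarrow> p ` V \<subseteq> {1..k} \<and>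
     (\<forall>(u, v)\<in>E. (u, v) \<in> P\<^sup>* \<or> (v, u) \<in> P\<^sup>*) \<and>
     (\<forall>u v w. (u, v) \<in> E \<longrightarrow> (u, w) \<in> P\<^sup>* \<longrightarrow> u \<noteq> w \<longrightarrow> (w, v) \<in> P\<^sup>* \<longrightarrow> p u \<noteq> p w)"

lemma pebble_forest_cover_iff_branching:
  assumes "pair_graph G"
  shows "(\<exists>F R p. pebble_forest_cover k G F R p \<and> forest_depth F R \<le> q) \<longleftrightarrow>
    (\<exists>P p. branching (pverts G) P \<and> pebbling k (pverts G) (parcs G) P p \<and>
       (\<forall>v\<in>pverts G. card {u. (u, v) \<in> P\<^sup>*} \<le> q))"
proof -
  interpret G: pair_graph G by fact
  have iff: "pebble_forest_cover k G (branching_graph (pverts G) P) (tops (pverts G) P) p \<longleftrightarrow>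
      pebbling k (pverts G) (parcs G) P p" if "branching (pverts G) P" for P p
  proof -
    interpret branching "pverts G" P by fact
    have sub: "(u, v) \<in> parcs G \<Longrightarrow> u \<in> pverts G \<and> v \<in> pverts G" for u v
      using G.in_arcsD1 G.in_arcsD2 by auto
    let ?anc = "anc (branching_graph (pverts G) P) (tops (pverts G) P)"
    let ?sanc = "sanc (branching_graph (pverts G) P) (tops (pverts G) P)"
    have comparable: "?anc u v \<or> ?anc v u \<longleftrightarrow> (u, v) \<in> P\<^sup>* \<or> (v, u) \<in> P\<^sup>*"
      if "(u, v) \<in> parcs G" for u v
      using sub[OF that] by (simp add: anc_iff)
    have between: "?sanc u v \<and> ?sanc u w \<and> ?anc w v \<longleftrightarrow> (u, w) \<in> P\<^sup>* \<and> u \<noteq> w \<and> (w, v) \<in> P\<^sup>*"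
      if "(u, v) \<in> parcs G" for u v w
      using sub[OF that] rtrancl_in_V[of w v] antisym[of u w] rtrancl_trans[of u w P v]
      by (auto simp: anc_iff sanc_iff)
    have "(\<forall>u v. (u, v) \<in> parcs G \<longrightarrow> ?anc u v \<or> ?anc v u) \<longleftrightarrow>
        (\<forall>(u, v)\<in>parcs G. (u, v) \<in> P\<^sup>* \<or> (v, u) \<in> P\<^sup>*)"
      using comparable by blast
    moreover have "(\<forall>u v. (u, v) \<in> parcs G \<and> ?sanc u v \<longrightarrow>
          (\<forall>w. ?sanc u w \<and> ?anc w v \<longrightarrow> p u \<noteq> p w)) \<longleftrightarrow>
        (\<forall>u v w. (u, v) \<in> parcs G \<longrightarrow> (u, w) \<in> P\<^sup>* \<longrightarrow> u \<noteq> w \<longrightarrow> (w, v) \<in> P\<^sup>* \<longrightarrow> p u \<noteq> p w)"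
      using between by meson
    ultimately show ?thesis
      using rooted_forest_branching_graph unfolding pebble_forest_cover_def pebbling_def by simp
  qed
  show ?thesis
  proof
    assume "\<exists>F R p. pebble_forest_cover k G F R p \<and> forest_depth F R \<le> q"
    then obtain F R p where F: "pebble_forest_cover k G F R p" "forest_depth F R \<le> q" by blast
    then have V: "pverts F = pverts G" and "rooted_forest F R"
      by (auto simp: pebble_forest_cover_def)
    then obtain P where P: "branching (pverts G) P" "F = branching_graph (pverts G) P"
        "R = tops (pverts G) P"
      using rooted_forest_branching[of F R] by metis
    then show "\<exists>P p. branching (pverts G) P \<and> pebbling k (pverts G) (parcs G) P p \<and>
       (\<forall>v\<in>pverts G. card {u. (u, v) \<in> P\<^sup>*} \<le> q)"
      using F iff[OF P(1)] branching.forest_depth_le_iff[OF P(1)] by metis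
  next
    assume "\<exists>P p. branching (pverts G) P \<and> pebbling k (pverts G) (parcs G) P p \<and>
       (\<forall>v\<in>pverts G. card {u. (u, v) \<in> P\<^sup>*} \<le> q)"
    then show "\<exists>F R p. pebble_forest_cover k G F R p \<and> forest_depth F R \<le> q"
      using iff branching.forest_depth_le_iff by metis
  qed
qed

text \<open>This turns connectivity into reachability from a topmost node, the form from which
  topmost bags are read off later. For the empty set both sides fail, as \<open>connected\<close>
  requires a vertex.\<close>

lemma (in branching) connected_induced_iff:
  assumes "S \<subseteq> V"
  shows "connected (with_proj (branching_graph V P) \<restriction> S) \<longleftrightarrow>
    (\<exists>t0\<in>S. \<forall>t\<in>S. (t0, t) \<in> (P \<inter> S \<times> S)\<^sup>*)"
proof (cases "S = {}")
  case True
  then show ?thesis by (simp add: connected_def strongly_connected_def)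
next
  case False
  let ?E = "(P \<union> P\<inverse>) \<inter> S \<times> S"
  have ends: "arcs_ends (with_proj (branching_graph V P) \<restriction> S) = ?E"
    by (auto simp: arcs_ends_def arc_to_ends_def image_def)
  have iff: "connected (with_proj (branching_graph V P) \<restriction> S) \<longleftrightarrow> (\<forall>u\<in>S. \<forall>v\<in>S. (u, v) \<in> ?E\<^sup>*)"
    using False by (subst connected_symmetric_iff) (auto simp: ends)
  have sym: "?E\<inverse> \<subseteq> ?E" by auto
  show ?thesis
  proof
    assume con: "connected (with_proj (branching_graph V P) \<restriction> S)"
    have "finite S" using assms finite_V finite_subset by blast
    then have "Min (level ` S) \<in> level ` S" using False by (intro Min_in) auto
    then obtain t0 where t0: "t0 \<in> S" "level t0 = Min (level ` S)" by auto
    then have min: "level t0 \<le> level t" if "t \<in> S" for t using that \<open>finite S\<close> by simp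
    \<comment> \<open>An undirected walk from \<open>t0\<close> may climb from \<open>a\<close> to
      \<open>b\<close>. By minimality \<open>a\<close> is not \<open>t0\<close>, so the downward
      path to \<open>a\<close> enters through the unique parent \<open>b\<close> and can be cut
      short there.\<close>
    have "(t0, t) \<in> (P \<inter> S \<times> S)\<^sup>*" if "(t0, t) \<in> ?E\<^sup>*" for t
      using that
    proof (induction rule: rtrancl_induct)
      case (step a b)
      show ?case
      proof (cases "(a, b) \<in> P")
        case True
        then show ?thesis using step by (auto intro: rtrancl_into_rtrancl)
      next
        case False
        then have ba: "(b, a) \<in> P" "b \<in> S" using step by auto
        then have "a \<noteq> t0" using min[of b] level_step[of b a] by auto
        with step.IH obtain c where "(t0, c) \<in> (P \<inter> S \<times> S)\<^sup>*" "(c, a) \<in> P"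
          by (auto elim: rtranclE)
        then show ?thesis using parent_unique ba by blast
      qed
    qed simp
    then show "\<exists>t0\<in>S. \<forall>t\<in>S. (t0, t) \<in> (P \<inter> S \<times> S)\<^sup>*"
      using con t0 iff by blast
  next
    assume "\<exists>t0\<in>S. \<forall>t\<in>S. (t0, t) \<in> (P \<inter> S \<times> S)\<^sup>*"
    then obtain t0 where t0: "\<And>t. t \<in> S \<Longrightarrow> (t0, t) \<in> (P \<inter> S \<times> S)\<^sup>*" by blast
    have "(P \<inter> S \<times> S)\<^sup>* \<subseteq> ?E\<^sup>*" by (rule rtrancl_mono) auto
    then have "(t0, t) \<in> ?E\<^sup>*" if "t \<in> S" for t using t0 that by blast
    moreover from this have "(t, t0) \<in> ?E\<^sup>*" if "t \<in> S" for t
      using that rtrancl_converse_subset[OF _ sym] by blast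
    ultimately show "connected (with_proj (branching_graph V P) \<restriction> S)"
      unfolding iff by (meson rtrancl_trans)
  qed
qed

definition branching_decomposition ::
  "'a pair_pre_digraph \<Rightarrow> 't set \<Rightarrow> 't rel \<Rightarrow> ('t \<Rightarrow> 'a set) \<Rightarrow> bool" where
  "branching_decomposition G N D \<beta> \<longleftrightarrow>
     (\<forall>t\<in>N. \<beta> t \<subseteq> pverts G) \<and> pverts G \<subseteq> (\<Union>t\<in>N. \<beta> t) \<and>
     (\<forall>(u, v)\<in>parcs G. \<exists>t\<in>N. u \<in> \<beta> t \<and> v \<in> \<beta> t) \<and>
     (\<forall>v\<in>pverts G. \<exists>t0\<in>{t\<in>N. v \<in> \<beta> t}. \<forall>t\<in>{t\<in>N. v \<in> \<beta> t}.
        (t0, t) \<in> (D \<inter> {t\<in>N. v \<in> \<beta> t} \<times> {t\<in>N. v \<in> \<beta> t})\<^sup>*)"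

text \<open>\<open>td_depth\<close> minimises over the roots: in one direction a minimising root
  orients the tree, in the other the given root bounds the minimum from above.\<close>

lemma tree_decomposition_iff_branching:
  fixes G :: "'a pair_pre_digraph"
  assumes "pair_graph G"
  shows "(\<exists>(T :: 't pair_pre_digraph) \<beta>.
       tree_decomposition G T \<beta> \<and> td_width T \<beta> \<le> int k - 1 \<and> td_depth T \<beta> \<le> q) \<longleftrightarrow>
    (\<exists>(N :: 't set) D r \<beta>. branching N D \<and> tops N D = {r} \<and> branching_decomposition G N D \<beta> \<and>
       (\<forall>t\<in>N. card (\<beta> t) \<le> k) \<and> (\<forall>t\<in>N. card (\<Union>s\<in>{s. (s, t) \<in> D\<^sup>*}. \<beta> s) \<le> q))"
    (is "?L \<longleftrightarrow> ?R")
proof -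
  have iff: "tree_decomposition G (branching_graph N D) \<beta> \<longleftrightarrow> branching_decomposition G N D \<beta>"
    if "branching N D" "tops N D = {r}" for N :: "'t set" and D r and \<beta> :: "'t \<Rightarrow> 'a set"
  proof -
    interpret branching N D by fact
    have "tree_graph (branching_graph N D)"
      using rooted_tree_branching_graph[OF that(2)] by (simp add: rooted_tree_def)
    moreover have "pre_digraph.Union (with_proj G) ((\<lambda>t. with_proj G \<restriction> \<beta> t) ` N) = with_proj G \<longleftrightarrow>
      pverts G = (\<Union>t\<in>N. \<beta> t) \<and> (\<forall>(u, v)\<in>parcs G. \<exists>t\<in>N. u \<in> \<beta> t \<and> v \<in> \<beta> t)"
    proof -
      have "pre_digraph.Union (with_proj G) ((\<lambda>t. with_proj G \<restriction> \<beta> t) ` N) = with_proj G \<longleftrightarrow>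
        (\<Union>t\<in>N. \<beta> t) = pverts G \<and> (\<Union>t\<in>N. {e \<in> parcs G. fst e \<in> \<beta> t \<and> snd e \<in> \<beta> t}) = parcs G"
        by (simp add: pre_digraph.Union_def with_proj_def induce_subgraph_def)
      moreover have "(\<Union>t\<in>N. {e \<in> parcs G. fst e \<in> \<beta> t \<and> snd e \<in> \<beta> t}) = parcs G \<longleftrightarrow>
        (\<forall>e\<in>parcs G. \<exists>t\<in>N. fst e \<in> \<beta> t \<and> snd e \<in> \<beta> t)"
        by blast
      ultimately show ?thesis by (auto simp: case_prod_beta)
    qed
    moreover have "connected (with_proj (branching_graph N D) \<restriction> {t \<in> N. v \<in> \<beta> t}) \<longleftrightarrow>
      (\<exists>t0\<in>{t\<in>N. v \<in> \<beta> t}. \<forall>t\<in>{t\<in>N. v \<in> \<beta> t}.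
        (t0, t) \<in> (D \<inter> {t\<in>N. v \<in> \<beta> t} \<times> {t\<in>N. v \<in> \<beta> t})\<^sup>*)" for v
      by (rule connected_induced_iff) auto
    ultimately show ?thesis
      unfolding tree_decomposition_def branching_decomposition_def branching_graph_simps
      by auto
  qed
  have width: "td_width (branching_graph N D) \<beta> \<le> int k - 1 \<longleftrightarrow> (\<forall>t\<in>N. card (\<beta> t) \<le> k)"
    if "branching N D" "N \<noteq> {}" for N :: "'t set" and D and \<beta> :: "'t \<Rightarrow> 'a set"
  proof -
    have "td_width (branching_graph N D) \<beta> \<le> int k - 1 \<longleftrightarrow> (MAX t\<in>N. card (\<beta> t)) \<le> k"
      by (simp add: td_width_def) linarith
    then show ?thesis using that branching.finite_V[OF that(1)] by simp
  qed
  have depth: "(MAX v\<in>N. card (\<Union>t\<in>{t. anc (branching_graph N D) {r} t v}. \<beta> t)) \<le> q \<longleftrightarrow>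
     (\<forall>t\<in>N. card (\<Union>s\<in>{s. (s, t) \<in> D\<^sup>*}. \<beta> s) \<le> q)"
    if "branching N D" "tops N D = {r}" for N :: "'t set" and D r and \<beta> :: "'t \<Rightarrow> 'a set"
  proof -
    interpret branching N D by fact
    have "N \<noteq> {}" using that(2) by (auto simp: tops_def)
    then show ?thesis using finite_V by (simp add: that(2)[symmetric] anc_iff)
  qed
  show ?thesis
  proof
    assume ?L
    then obtain T :: "'t pair_pre_digraph" and \<beta> where
      T: "tree_decomposition G T \<beta>" "td_width T \<beta> \<le> int k - 1" "td_depth T \<beta> \<le> q" by blast
    have tree: "tree_graph T" using T(1) by (simp add: tree_decomposition_def)
    then have fin: "finite (pverts T)" and ne: "pverts T \<noteq> {}"
      by (auto simp: tree_graph_def forest_graph_def connected_def strongly_connected_def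
          pair_graph_def pair_digraph_def pair_fin_digraph.pair_finite_verts)
    let ?f = "\<lambda>r. MAX v\<in>pverts T. card (\<Union>t\<in>{t. anc T {r} t v}. \<beta> t)"
    have "td_depth T \<beta> \<in> ?f ` pverts T"
      unfolding td_depth_def using fin ne by (intro Min_in) auto
    then obtain r where r: "r \<in> pverts T" "?f r \<le> q" using T(3) by auto
    then have "rooted_tree T r" using tree by (simp add: rooted_tree_def)
    then obtain D where D: "branching (pverts T) D" "T = branching_graph (pverts T) D"
        "tops (pverts T) D = {r}" by (rule rooted_tree_branching)
    have "branching_decomposition G (pverts T) D \<beta>"
      using iff[OF D(1,3), of \<beta>] T(1) unfolding D(2)[symmetric] by simp
    moreover have "\<forall>t\<in>pverts T. card (\<beta> t) \<le> k"
      using width[OF D(1) ne, of \<beta>] T(2) unfolding D(2)[symmetric] by simp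
    moreover have "\<forall>t\<in>pverts T. card (\<Union>s\<in>{s. (s, t) \<in> D\<^sup>*}. \<beta> s) \<le> q"
      using depth[OF D(1,3), of \<beta>] r(2) unfolding D(2)[symmetric] by simp
    ultimately show ?R using D(1,3) by blast
  next
    assume ?R
    then obtain N :: "'t set" and D r \<beta> where D: "branching N D" "tops N D = {r}" and
      \<beta>: "branching_decomposition G N D \<beta>" "\<forall>t\<in>N. card (\<beta> t) \<le> k"
        "\<forall>t\<in>N. card (\<Union>s\<in>{s. (s, t) \<in> D\<^sup>*}. \<beta> s) \<le> q" by blast
    have r: "r \<in> N" using D(2) by (auto simp: tops_def)
    have "td_depth (branching_graph N D) \<beta> \<le>
        (MAX v\<in>N. card (\<Union>t\<in>{t. anc (branching_graph N D) {r} t v}. \<beta> t))"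
      unfolding td_depth_def using r branching.finite_V[OF D(1)] by (intro Min_le) auto
    also have "\<dots> \<le> q" using depth[OF D] \<beta>(3) by blast
    finally show ?L using iff[OF D] width[OF D(1)] \<beta> r by blast
  qed
qed

section \<open>From tree decompositions to forest covers\<close>

text \<open>The parent is the immediate predecessor: two immediate predecessors of the same element
  would be comparable, and the lower one would not be immediate. By induction on the number of
  elements strictly between \<open>u\<close> and \<open>v\<close>, every comparison splits into
  covering steps.\<close>

lemma branching_of_order:
  fixes lt :: "'a rel"
  assumes "finite V" "lt \<subseteq> V \<times> V" "trans lt" "irrefl lt"
    and linear_below: "\<And>u w v. (u, v) \<in> lt \<Longrightarrow> (w, v) \<in> lt \<Longrightarrow> u = w \<or> (u, w) \<in> lt \<or> (w, u) \<in> lt"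
  obtains P where "branching V P" "P\<^sup>+ = lt"
proof -
  define P where "P = {(u, v) \<in> lt. \<forall>w. (u, w) \<in> lt \<longrightarrow> (w, v) \<notin> lt}"
  have "P\<^sup>+ \<subseteq> lt\<^sup>+" by (rule trancl_mono_subset) (auto simp: P_def)
  then have sub: "P\<^sup>+ \<subseteq> lt" using assms(3) by (simp add: trancl_id)
  have "(u, v) \<in> P\<^sup>+" if "(u, v) \<in> lt" for u v
    using that
  proof (induction "card {w. (u, w) \<in> lt \<and> (w, v) \<in> lt}" arbitrary: u v rule: less_induct)
    case less
    have fin: "finite {w. (u, w) \<in> lt \<and> (w, v) \<in> lt}"
      using assms(1,2) by (auto intro: finite_subset[of _ V])
    show ?case
    proof (cases "\<exists>w. (u, w) \<in> lt \<and> (w, v) \<in> lt")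
      case True
      then obtain w where w: "(u, w) \<in> lt" "(w, v) \<in> lt" by blast
      have "{x. (u, x) \<in> lt \<and> (x, w) \<in> lt} \<subset> {w. (u, w) \<in> lt \<and> (w, v) \<in> lt}"
        using w assms(3,4) by (auto simp: irrefl_def dest: transD)
      moreover have "{x. (w, x) \<in> lt \<and> (x, v) \<in> lt} \<subset> {w. (u, w) \<in> lt \<and> (w, v) \<in> lt}"
        using w assms(3,4) by (auto simp: irrefl_def dest: transD)
      ultimately show ?thesis
        using less.hyps w psubset_card_mono[OF fin] by (meson trancl_trans)
    next
      case False
      then show ?thesis using less.prems by (auto simp: P_def)
    qed
  qed
  then have eq: "P\<^sup>+ = lt" using sub by auto
  moreover have "branching V P"
  proof
    show "acyclic P" using eq assms(4) by (auto simp: acyclic_def irrefl_def)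
    show "u = u'" if "(u, v) \<in> P" "(u', v) \<in> P" for u u' v
      using that linear_below[of u v u'] by (auto simp: P_def)
  qed (use assms(1,2) in \<open>auto simp: P_def\<close>)
  ultimately show thesis using that by blast
qed

text \<open>When the turn of \<open>v\<close> comes in the well-founded recursion, its predecessors
  have taken fewer than \<open>k\<close> colours.\<close>

lemma greedy_colouring:
  fixes C :: "'a rel" and k :: nat
  assumes "wf C" and deg: "\<And>v. finite {u. (u, v) \<in> C}" "\<And>v. card {u. (u, v) \<in> C} < k"
  shows "\<exists>p. (\<forall>v. p v \<in> {1..k}) \<and> (\<forall>(u, v)\<in>C. p u \<noteq> p v)"
proof -
  define H where "H = (\<lambda>p v. SOME c. c \<in> {1..k} \<and> (\<forall>u. (u, v) \<in> C \<longrightarrow> p u \<noteq> c))"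
  define p where "p = wfrec C H"
  \<comment> \<open>\<open>H\<close> consults \<open>p\<close> only at the
    \<open>C\<close>-predecessors of \<open>v\<close>, which is what the recursion equation asks
    for.\<close>
  have "adm_wf C H"
    unfolding adm_wf_def H_def by (intro allI impI arg_cong[where f = Eps]) auto
  then have p: "p v = H p v" for v
    using wfrec_fixpoint[OF assms(1)] unfolding p_def by metis
  have "p v \<in> {1..k} \<and> (\<forall>u. (u, v) \<in> C \<longrightarrow> p u \<noteq> p v)" for v
  proof -
    have "card (p ` {u. (u, v) \<in> C}) < card {1..k}"
      using card_image_le[OF deg(1), of p v] deg(2)[of v] by simp
    then have "\<not> {1..k} \<subseteq> p ` {u. (u, v) \<in> C}"
      using card_mono[OF finite_imageI[OF deg(1)]] by (metis not_less)
    then have "\<exists>c. c \<in> {1..k} \<and> (\<forall>u. (u, v) \<in> C \<longrightarrow> p u \<noteq> c)" by blast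
    from someI_ex[OF this] show ?thesis unfolding p[of v, unfolded H_def] .
  qed
  then show ?thesis by blast
qed

text \<open>The downward path between two nodes is unique, so the one inside \<open>S\<close> passes
  through every node in between.\<close>

lemma (in branching) restrict_convex:
  assumes "(a, t) \<in> (P \<inter> S \<times> S)\<^sup>*" "a \<in> S" "(a, b) \<in> P\<^sup>*" "(b, t) \<in> P\<^sup>*"
  shows "b \<in> S"
  using assms(1,4)
proof (induction rule: rtrancl_induct)
  case base
  then show ?case using assms antisym by blast
next
  case (step y z)
  then show ?case using ancestor_step[of b z y] by auto
qed

lemma branching_decomposition_imp_pebbling:
  fixes G :: "'a pair_pre_digraph"
  assumes "pair_graph G" "branching N D" "branching_decomposition G N D \<beta>"
    and width: "\<And>t. t \<in> N \<Longrightarrow> card (\<beta> t) \<le> k"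
    and depth: "\<And>t. t \<in> N \<Longrightarrow> card (\<Union>s\<in>{s. (s, t) \<in> D\<^sup>*}. \<beta> s) \<le> q"
  shows "\<exists>P p. branching (pverts G) P \<and> pebbling k (pverts G) (parcs G) P p \<and>
       (\<forall>v\<in>pverts G. card {u. (u, v) \<in> P\<^sup>*} \<le> q)"
proof -
  interpret G: pair_graph G by fact
  interpret T: branching N D by fact
  let ?V = "pverts G"
  have bag: "\<And>t. t \<in> N \<Longrightarrow> \<beta> t \<subseteq> ?V"
    and edge: "\<And>u v. (u, v) \<in> parcs G \<Longrightarrow> \<exists>t\<in>N. u \<in> \<beta> t \<and> v \<in> \<beta> t"
    using assms(3) by (auto simp: branching_decomposition_def)
  have finite_bag: "finite (\<beta> t)" if "t \<in> N" for t
    using bag[OF that] G.pair_finite_verts finite_subset by blast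
  let ?S = "\<lambda>v. {t \<in> N. v \<in> \<beta> t}"
  have "\<forall>v\<in>?V. \<exists>t0. t0 \<in> ?S v \<and> (\<forall>t\<in>?S v. (t0, t) \<in> (D \<inter> ?S v \<times> ?S v)\<^sup>*)"
    using assms(3) unfolding branching_decomposition_def by blast
  from bchoice[OF this] obtain top where "\<forall>v\<in>?V. top v \<in> ?S v \<and>
      (\<forall>t\<in>?S v. (top v, t) \<in> (D \<inter> ?S v \<times> ?S v)\<^sup>*)" ..
  then have top_in: "\<And>v. v \<in> ?V \<Longrightarrow> top v \<in> ?S v"
    and top_below: "\<And>v t. v \<in> ?V \<Longrightarrow> t \<in> ?S v \<Longrightarrow> (top v, t) \<in> (D \<inter> ?S v \<times> ?S v)\<^sup>*"
    by blast+
  have top_anc: "(top v, t) \<in> D\<^sup>*" if "t \<in> N" "v \<in> \<beta> t" for v t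
    using top_below[of v t] that bag rtrancl_mono[of "D \<inter> ?S v \<times> ?S v" D] by blast
  obtain f :: "'a \<Rightarrow> nat" where f: "inj_on f ?V"
    using finite_imp_inj_to_nat_seg[OF G.pair_finite_verts] by blast
  \<comment> \<open>The injection \<open>f\<close> into the naturals breaks ties between vertices
    with the same topmost bag.\<close>
  define lt where "lt = {(u, v) \<in> ?V \<times> ?V. (top u, top v) \<in> D\<^sup>+ \<or> top u = top v \<and> f u < f v}"
  have acyc: "(t, t) \<notin> D\<^sup>+" for t using T.acyclic_P by (simp add: acyclic_def)
  have total: "u = v \<or> (u, v) \<in> lt \<or> (v, u) \<in> lt"
    if "u \<in> ?V" "v \<in> ?V" "(top u, t) \<in> D\<^sup>*" "(top v, t) \<in> D\<^sup>*" for u v t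
  proof (cases "top u = top v")
    case True
    then show ?thesis using that inj_onD[OF f, of u v] by (auto simp: lt_def)
  next
    case False
    then show ?thesis using that T.ancestors_comparable[OF that(3,4)]
      by (auto simp: lt_def rtrancl_eq_or_trancl)
  qed
  have lt_top: "(top u, top v) \<in> D\<^sup>*" if "(u, v) \<in> lt" for u v
    using that by (auto simp: lt_def trancl_into_rtrancl)
  obtain P where P: "branching ?V P" "P\<^sup>+ = lt"
  proof (rule branching_of_order[of ?V lt])
    show "trans lt" by (auto simp: lt_def trans_def intro: trancl_trans)
    show "irrefl lt" using acyc by (auto simp: lt_def irrefl_def)
    show "u = w \<or> (u, w) \<in> lt \<or> (w, u) \<in> lt" if "(u, v) \<in> lt" "(w, v) \<in> lt" for u w v
      using that total[of u w "top v"] lt_top by (auto simp: lt_def)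
  qed (use G.pair_finite_verts in \<open>auto simp: lt_def\<close>)
  have P_rtrancl: "(u, v) \<in> P\<^sup>* \<longleftrightarrow> u = v \<or> (u, v) \<in> lt" for u v
    using P(2) by (auto simp: rtrancl_eq_or_trancl)
  \<comment> \<open>Only smaller vertices in the topmost bag of \<open>v\<close> conflict with
    \<open>v\<close>. As \<open>v\<close> occupies one of the at most \<open>k\<close> places there,
    fewer than \<open>k\<close> conflicts remain.\<close>
  define C where "C = {(u, v) \<in> lt. u \<in> \<beta> (top v)}"
  have "finite lt" using G.pair_finite_verts by (auto simp: lt_def intro: finite_subset[of _ "?V \<times> ?V"])
  moreover have "acyclic lt"
    using P(2) branching.acyclic_P[OF P(1)] by (metis acyclic_def trancl_id trans_trancl)
  ultimately have "wf lt" by (rule finite_acyclic_wf)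
  then have "wf C" by (rule wf_subset) (auto simp: C_def)
  have C: "finite {u. (u, v) \<in> C}" "card {u. (u, v) \<in> C} < k" if "v \<in> ?V" for v
  proof -
    have "{u. (u, v) \<in> C} \<subseteq> \<beta> (top v) - {v}"
      using acyc by (auto simp: C_def lt_def)
    moreover have "finite (\<beta> (top v))" "card (\<beta> (top v)) \<le> k" "v \<in> \<beta> (top v)"
      using top_in[OF that] finite_bag width by auto
    ultimately have "{u. (u, v) \<in> C} \<subset> \<beta> (top v)" "finite (\<beta> (top v))" "card (\<beta> (top v)) \<le> k"
      by auto
    then show "finite {u. (u, v) \<in> C}" "card {u. (u, v) \<in> C} < k"
      using psubset_card_mono[of "\<beta> (top v)" "{u. (u, v) \<in> C}"]
      by (meson finite_subset psubset_imp_subset, linarith)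
  qed
  have "\<exists>p. p ` ?V \<subseteq> {1..k} \<and> (\<forall>(u, v)\<in>C. p u \<noteq> p v)"
  proof (cases "?V = {}")
    case True
    then show ?thesis by (auto simp: C_def lt_def)
  next
    case False
    \<comment> \<open>The colouring bound is demanded for every \<open>v\<close> of the type.
      Outside the graph it reads \<open>0 < k\<close>, which any vertex of the graph supplies; this
      is why the empty graph is split off.\<close>
    have out: "{u. (u, v) \<in> C} = {}" if "v \<notin> ?V" for v using that by (auto simp: C_def lt_def)
    have "finite {u. (u, v) \<in> C} \<and> card {u. (u, v) \<in> C} < k" for v
    proof (cases "v \<in> ?V")
      case False
      then show ?thesis using C \<open>?V \<noteq> {}\<close> unfolding out[OF False] by fastforce
    qed (use C in auto)
    then have deg: "\<And>v. finite {u. (u, v) \<in> C}" "\<And>v. card {u. (u, v) \<in> C} < k" by simp_all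
    from greedy_colouring[OF \<open>wf C\<close> deg]
    obtain p where "\<forall>v. p v \<in> {1..k}" and col: "\<forall>(u, v)\<in>C. p u \<noteq> p v" by (elim exE conjE)
    then have "p ` ?V \<subseteq> {1..k}" by (simp add: image_subset_iff)
    with col show ?thesis by (intro exI[of _ p] conjI)
  qed
  then obtain p where p: "p ` ?V \<subseteq> {1..k}" and "\<forall>(u, v)\<in>C. p u \<noteq> p v" by (elim exE conjE)
  then have p_neq: "p u \<noteq> p v" if "(u, v) \<in> C" for u v using that by auto
  have "pebbling k ?V (parcs G) P p"
    unfolding pebbling_def
  proof (intro conjI allI impI ballI p, clarify)
    fix u v assume uv: "(u, v) \<in> parcs G" "(v, u) \<notin> P\<^sup>*"
    then obtain t where t: "t \<in> N" "u \<in> \<beta> t" "v \<in> \<beta> t" using edge by blast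
    then show "(u, v) \<in> P\<^sup>*"
      using uv total[of u v t] top_anc bag[OF t(1)] by (auto simp: P_rtrancl)
  next
    fix u v w
    assume uv: "(u, v) \<in> parcs G" and uw: "(u, w) \<in> P\<^sup>*" "u \<noteq> w" and wv: "(w, v) \<in> P\<^sup>*"
    then obtain t where t: "t \<in> N" "u \<in> \<beta> t" "v \<in> \<beta> t" using edge by blast
    have lt: "(u, w) \<in> lt" using uw by (simp add: P_rtrancl)
    then have V: "u \<in> ?V" "w \<in> ?V" by (auto simp: lt_def)
    have "(top w, top v) \<in> D\<^sup>*" using wv lt_top by (auto simp: P_rtrancl)
    also have "(top v, t) \<in> D\<^sup>*" using top_anc t by blast
    finally have "(top w, t) \<in> D\<^sup>*" .
    moreover have "(top u, top w) \<in> D\<^sup>*" using lt lt_top by blast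
    \<comment> \<open>\<open>top w\<close> lies between \<open>top u\<close> and a node
      \<open>t\<close> whose bag contains the edge, and \<open>u\<close> is in the bags of both. By
      convexity \<open>u\<close> is in the topmost bag of \<open>w\<close>, so \<open>(u, w)\<close>
      is a conflict.\<close>
    ultimately have "top w \<in> ?S u"
      using T.restrict_convex[OF top_below[of u t] top_in] V t by auto
    then show "p u \<noteq> p w" using lt p_neq[of u w] by (auto simp: C_def)
  qed
  moreover have "card {u. (u, v) \<in> P\<^sup>*} \<le> q" if v: "v \<in> ?V" for v
  proof -
    have top: "top v \<in> N" using top_in v by auto
    \<comment> \<open>An ancestor \<open>u\<close> of \<open>v\<close> lies in its own topmost bag,
      which is at or above \<open>top v\<close>; thus the depth of the decomposition counts
      it.\<close>
    have "{u. (u, v) \<in> P\<^sup>*} \<subseteq> (\<Union>s\<in>{s. (s, top v) \<in> D\<^sup>*}. \<beta> s)"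
      using top_in v lt_top by (fastforce simp: P_rtrancl lt_def)
    moreover have "finite (\<Union>s\<in>{s. (s, top v) \<in> D\<^sup>*}. \<beta> s)"
      using T.finite_ancestors T.rtrancl_in_V top finite_bag by auto
    ultimately show ?thesis using depth[OF top] by (meson card_mono le_trans)
  qed
  ultimately show ?thesis using P(1) by blast
qed

section \<open>From forest covers to construction trees\<close>

context branching
begin

lemma construction_tree_iff:
  assumes "tops V P = {r}"
  shows "construction_tree k G (branching_graph V P) r \<Lambda> \<longleftrightarrow>
    (\<forall>t\<in>V. k_labelled k (\<Lambda> t)) \<and> labelled_iso (\<Lambda> r) G \<and>
    (\<forall>t\<in>V. {s. (t, s) \<in> P} = {} \<longrightarrow> fully_labelled (\<Lambda> t)) \<and>
    (\<forall>t\<in>V. \<forall>t'. {s. (t, s) \<in> P} = {t'} \<longrightarrow>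
      (\<exists>l\<in>dom (labelling (\<Lambda> t')). labelled_iso (\<Lambda> t) (remove_label l (\<Lambda> t')))) \<and>
    (\<forall>t\<in>V. card {s. (t, s) \<in> P} > 1 \<longrightarrow>
      labelled_iso (\<Lambda> t) (labelled_product {s. (t, s) \<in> P} \<Lambda>))"
  using rooted_tree_branching_graph[OF assms]
  unfolding construction_tree_def assms[symmetric] by (auto simp: children_eq leaves_eq)

text \<open>Elimination nodes only accumulate on the way down, so a bound at the leaves is a bound
  at every node.\<close>

lemma elimination_depth_le_iff:
  assumes "tops V P = {r}"
  shows "elimination_depth (branching_graph V P) r \<le> q \<longleftrightarrow>
    (\<forall>t\<in>V. card {s. (s, t) \<in> P\<^sup>* \<and> card {c. (s, c) \<in> P} = 1} \<le> q)"
proof -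
  let ?A = "\<lambda>t. {s. (s, t) \<in> P\<^sup>* \<and> card {c. (s, c) \<in> P} = 1}"
  let ?L = "{t \<in> V. \<forall>s. (t, s) \<notin> P}"
  have below: "\<exists>t\<in>?L. (v, t) \<in> P\<^sup>*" if "v \<in> V" for v
    using that minimal_below[of v] rtrancl_in_V' by blast
  have "r \<in> V" using assms by (auto simp: tops_def)
  with below have "?L \<noteq> {}" by blast
  have eq: "{s \<in> elimination_nodes (branching_graph V P) r. anc (branching_graph V P) {r} s t} = ?A t"
    if "t \<in> V" for t
    using that rtrancl_in_V by (auto simp: elimination_nodes_def assms[symmetric] children_eq anc_iff)
  have "elimination_depth (branching_graph V P) r = (MAX t\<in>?L. card (?A t))"
    unfolding elimination_depth_def assms[symmetric] leaves_eq
    by (intro arg_cong[where f = Max] image_cong refl) (use eq in \<open>auto simp: assms\<close>)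
  then have "elimination_depth (branching_graph V P) r \<le> q \<longleftrightarrow> (\<forall>t\<in>?L. card (?A t) \<le> q)"
    using finite_V \<open>?L \<noteq> {}\<close> by simp
  moreover have "card (?A s) \<le> card (?A t)" if "(s, t) \<in> P\<^sup>*" for s t
    using that by (intro card_mono finite_subset[OF _ finite_ancestors[of t]]) (auto intro: rtrancl_trans)
  then have "(\<forall>t\<in>?L. card (?A t) \<le> q) \<longleftrightarrow> (\<forall>t\<in>V. card (?A t) \<le> q)"
    using below by (auto intro: order_trans) (meson le_trans)
  ultimately show ?thesis by blast
qed

section \<open>Renaming parent relations along injections\<close>

lemma image_stepE:
  assumes "inj_on f V" "u \<in> V" "(f u, y) \<in> map_prod f f ` P"
  obtains v where "v \<in> V" "y = f v" "(u, v) \<in> P"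
proof -
  obtain a b where ab: "(a, b) \<in> P" "f u = f a" "y = f b" using assms(3) by auto
  then have "u = a" using assms(1,2) in_V(1) by (blast dest: inj_onD)
  then show thesis using ab in_V that by blast
qed

lemma image_rtrancl_iff:
  assumes "inj_on f V" "u \<in> V" "v \<in> V"
  shows "(f u, f v) \<in> (map_prod f f ` P)\<^sup>* \<longleftrightarrow> (u, v) \<in> P\<^sup>*"
proof
  have reach: "\<exists>v\<in>V. y = f v \<and> (u, v) \<in> P\<^sup>*" if "(f u, y) \<in> (map_prod f f ` P)\<^sup>*" for y
    using that
  proof (induction rule: rtrancl_induct)
    case base
    then show ?case using assms by blast
  next
    case (step y z)
    then obtain v where v: "v \<in> V" "y = f v" "(u, v) \<in> P\<^sup>*" by blast
    have "(f v, z) \<in> map_prod f f ` P" using step v by simp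
    then obtain w where "w \<in> V" "z = f w" "(v, w) \<in> P" by (rule image_stepE[OF assms(1) v(1)])
    then show ?case using v by (metis rtrancl_into_rtrancl)
  qed
  assume "(f u, f v) \<in> (map_prod f f ` P)\<^sup>*"
  from reach[OF this] obtain w where "w \<in> V" "f v = f w" "(u, w) \<in> P\<^sup>*" by blast
  then show "(u, v) \<in> P\<^sup>*" using inj_onD[OF assms(1), of v w] assms(3) by simp
next
  show "(f u, f v) \<in> (map_prod f f ` P)\<^sup>*" if "(u, v) \<in> P\<^sup>*"
    using that
  proof (induction rule: rtrancl_induct)
    case (step y z)
    then have "(f y, f z) \<in> map_prod f f ` P" by force
    then show ?case using step.IH by (rule rtrancl_into_rtrancl[rotated])
  qed simp
qed

lemma branching_image:
  assumes "inj_on f V"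
  shows "branching (f ` V) (map_prod f f ` P)"
proof
  fix u v u' assume "(u, v) \<in> map_prod f f ` P" "(u', v) \<in> map_prod f f ` P"
  then obtain a b a' b' where ab: "(a, b) \<in> P" "(a', b') \<in> P" "u = f a" "u' = f a'" "f b = f b'"
    by auto
  then have "b = b'" using assms in_V(2) by (blast dest: inj_onD)
  then show "u = u'" using ab parent_unique by blast
next
  show "acyclic (map_prod f f ` P)"
    by (rule acyclic_rank[where f = "\<lambda>x. level (inv_into V f x)"])
      (use assms in_V in \<open>auto simp: level_step\<close>)
qed (use finite_V P_subset in auto)

lemma image_children:
  assumes "inj_on f V" "t \<in> V"
  shows "{s. (f t, s) \<in> map_prod f f ` P} = f ` {s. (t, s) \<in> P}"
  by (auto elim!: image_stepE[OF assms])

lemma tops_image: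
  assumes "inj_on f V"
  shows "tops (f ` V) (map_prod f f ` P) = f ` tops V P"
proof -
  have "(\<exists>y. (y, f v) \<in> map_prod f f ` P) \<longleftrightarrow> (\<exists>u. (u, v) \<in> P)" if "v \<in> V" for v
  proof
    assume "\<exists>y. (y, f v) \<in> map_prod f f ` P"
    then obtain a b where "(a, b) \<in> P" "f v = f b" by auto
    then show "\<exists>u. (u, v) \<in> P" using that in_V(2) assms by (metis inj_onD)
  qed auto
  then show ?thesis by (fastforce simp: tops_def)
qed

lemma image_ancestors:
  assumes "inj_on f V" "t \<in> V"
  shows "{s. (s, f t) \<in> (map_prod f f ` P)\<^sup>*} = f ` {s. (s, t) \<in> P\<^sup>*}"
proof -
  interpret I: branching "f ` V" "map_prod f f ` P" using branching_image assms by blast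
  show ?thesis
    using I.rtrancl_in_V[of _ "f t"] rtrancl_in_V[of _ t] image_rtrancl_iff[OF assms(1)] assms(2) by blast
qed

end

lemma pebbling_image:
  assumes "branching V P" "inj_on f V" "E \<subseteq> V \<times> V" "pebbling k V E P p"
  shows "pebbling k (f ` V) (map_prod f f ` E) (map_prod f f ` P) (p \<circ> inv_into V f)"
proof -
  interpret branching V P by fact
  interpret I: branching "f ` V" "map_prod f f ` P" using branching_image assms by blast
  note iff = image_rtrancl_iff[OF assms(2)]
  have E: "u \<in> V" "v \<in> V" if "(u, v) \<in> E" for u v using that assms(3) by auto
  have comparable: "(u, v) \<in> P\<^sup>* \<or> (v, u) \<in> P\<^sup>*" if "(u, v) \<in> E" for u v
    using that assms(4) by (auto simp: pebbling_def)
  have neq: "p u \<noteq> p w" if "(u, v) \<in> E" "(u, w) \<in> P\<^sup>*" "u \<noteq> w" "(w, v) \<in> P\<^sup>*" for u v w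
    using that assms(4) by (auto simp: pebbling_def)
  show ?thesis
    unfolding pebbling_def
  proof (intro conjI ballI allI impI)
    show "(p \<circ> inv_into V f) ` f ` V \<subseteq> {1..k}"
      using assms(2,4) by (auto simp: pebbling_def image_subset_iff)
    show "case e of (u, v) \<Rightarrow> (u, v) \<in> (map_prod f f ` P)\<^sup>* \<or> (v, u) \<in> (map_prod f f ` P)\<^sup>*"
      if e: "e \<in> map_prod f f ` E" for e
    proof -
      obtain u v where "(u, v) \<in> E" "e = (f u, f v)" using e by auto
      then show ?thesis using comparable[of u v] E[of u v] iff[of u v] iff[of v u] by simp
    qed
  next
    fix u v w
    assume uv: "(u, v) \<in> map_prod f f ` E" "(u, w) \<in> (map_prod f f ` P)\<^sup>*" "u \<noteq> w"
      "(w, v) \<in> (map_prod f f ` P)\<^sup>*"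
    then obtain u' v' where e: "(u', v') \<in> E" "u = f u'" "v = f v'" by auto
    then have "w \<in> f ` V" using I.rtrancl_in_V uv(4) E by blast
    then obtain w' where "w' \<in> V" "w = f w'" by blast
    then show "(p \<circ> inv_into V f) u \<noteq> (p \<circ> inv_into V f) w"
      using neq[of u' v' w'] iff uv e E assms(2) by auto
  qed
qed

text \<open>A criterion that avoids quotients: when the factors are overlapping parts of one graph,
  a label means the same vertex in all of them, and two factors overlap only in vertices with a
  common label, the product is the plain union.\<close>

lemma labelled_product_iso:
  assumes ran: "\<And>i. i \<in> I \<Longrightarrow> ran (labelling (M i)) \<subseteq> pverts (graph_of (M i))"
    and arcs: "\<And>i. i \<in> I \<Longrightarrow>
      parcs (graph_of (M i)) \<subseteq> pverts (graph_of (M i)) \<times> pverts (graph_of (M i))"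
    and consistent: "\<And>i j l u v. i \<in> I \<Longrightarrow> j \<in> I \<Longrightarrow> labelling (M i) l = Some u \<Longrightarrow>
      labelling (M j) l = Some v \<Longrightarrow> u = v"
    and shared: "\<And>i j u. i \<in> I \<Longrightarrow> j \<in> I \<Longrightarrow> i \<noteq> j \<Longrightarrow> u \<in> pverts (graph_of (M i)) \<Longrightarrow>
      u \<in> pverts (graph_of (M j)) \<Longrightarrow> \<exists>l. labelling (M i) l = Some u \<and> labelling (M j) l = Some u"
    and pverts: "pverts (graph_of L) = (\<Union>i\<in>I. pverts (graph_of (M i)))"
    and parcs: "parcs (graph_of L) = (\<Union>i\<in>I. parcs (graph_of (M i)))"
    and lab: "\<And>l u. labelling L l = Some u \<longleftrightarrow> (\<exists>i\<in>I. labelling (M i) l = Some u)"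
  shows "labelled_iso L (labelled_product I M)"
proof -
  \<comment> \<open>The glue class of \<open>u\<close> consists of its copies in all factors:
    consistent labels never glue copies of different vertices, and by \<open>shared\<close> any two
    copies of \<open>u\<close> are glued in one step.\<close>
  define f where "f u = {(i, u) | i. i \<in> I \<and> u \<in> pverts (graph_of (M i))}" for u
  have ranD: "u \<in> pverts (graph_of (M i))" if "i \<in> I" "labelling (M i) l = Some u" for i l u
    using ran[OF that(1)] that(2) by (auto simp: ran_def)
  have class_eq: "glue_class I M i u = f u" if i: "i \<in> I" "u \<in> pverts (graph_of (M i))" for i u
  proof -
    have "(j, v) \<in> f u" if "((i, u), (j, v)) \<in> (glue I M)\<^sup>*" for j v
      using that
    proof (induction rule: rtrancl_induct2)
      case (step j v j' v')
      then have "v = u" "j \<in> I" "j' \<in> I" by (simp_all add: f_def glue_def)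
      moreover obtain l where "labelling (M j) l = Some v" "labelling (M j') l = Some v'"
        using step.hyps by (auto simp: glue_def)
      ultimately show ?case using consistent[of j j' l v v'] ranD[of j' l v'] by (simp add: f_def)
    qed (simp add: f_def i)
    moreover have "((i, u), (j, u)) \<in> (glue I M)\<^sup>*" if "j \<in> I" "u \<in> pverts (graph_of (M j))" for j
    proof (cases "i = j")
      case False
      then show ?thesis
        using shared[of i j u] i that by (intro r_into_rtrancl) (auto simp: glue_def)
    qed simp
    ultimately show ?thesis by (auto simp: glue_class_def f_def)
  qed
  have "inj_on f (pverts (graph_of L))"
    unfolding pverts by (auto simp: inj_on_def f_def set_eq_iff)
  moreover have "f ` pverts (graph_of L) = pverts (graph_of (labelled_product I M))"
    unfolding pverts by (force simp: labelled_product_def class_eq image_iff)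
  moreover have "parcs (graph_of (labelled_product I M)) = map_prod f f ` parcs (graph_of L)"
  proof -
    have "(glue_class I M i u, glue_class I M i v) = (f u, f v)"
      if "i \<in> I" "(u, v) \<in> parcs (graph_of (M i))" for i u v
      using arcs[OF that(1)] that class_eq by auto
    then show ?thesis
      unfolding parcs by (force simp: labelled_product_def image_iff)
  qed
  moreover have "labelling (labelled_product I M) l = map_option f (labelling L l)" for l
  proof (cases "\<exists>i\<in>I. l \<in> dom (labelling (M i))")
    case True
    then obtain i u where iu: "i \<in> I" "labelling (M i) l = Some u" by auto
    then have L: "labelling L l = Some u" using lab by blast
    have "(THE c. \<exists>i\<in>I. \<exists>u. labelling (M i) l = Some u \<and> c = glue_class I M i u) = f u"
    proof (rule the_equality)
      show "\<exists>i\<in>I. \<exists>u'. labelling (M i) l = Some u' \<and> f u = glue_class I M i u'"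
        using iu class_eq ranD by metis
    next
      fix c assume "\<exists>i\<in>I. \<exists>u. labelling (M i) l = Some u \<and> c = glue_class I M i u"
      then obtain j v where "j \<in> I" "labelling (M j) l = Some v" "c = glue_class I M j v" by blast
      then show "c = f u" using iu consistent[of i j l u v] class_eq ranD by auto
    qed
    then show ?thesis using True L by (simp add: labelled_product_def)
  next
    case False
    then have "labelling L l = None" using lab by (cases "labelling L l") auto
    then show ?thesis using False by (simp add: labelled_product_def)
  qed
  ultimately show ?thesis
    unfolding labelled_iso_def by (intro exI[of _ f]) (auto simp: bij_betw_def)
qed

text \<open>
  The copies \<open>Leaf x True\<close> and \<open>Leaf x False\<close> give every product node at least two
  children, so that the elimination nodes are exactly the nodes \<open>Elim v\<close>. The value \<open>None\<close>
  stands for a virtual root above all roots of the forest.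
\<close>

datatype 'a cnode = Prod "'a option" | Elim 'a | Leaf "'a option" bool

section \<open>The construction tree of a pebbled forest\<close>

locale pebble_cover = branching V P
  for V :: "'a set" and P :: "'a rel" +
  fixes k :: nat and E :: "'a rel" and p :: "'a \<Rightarrow> nat"
  assumes pebbling: "pebbling k V E P p"
    and E_subset: "E \<subseteq> V \<times> V"
    and E_sym: "(u, v) \<in> E \<Longrightarrow> (v, u) \<in> E"
    and E_irrefl: "(u, u) \<notin> E"
begin

lemma p_range: "v \<in> V \<Longrightarrow> p v \<in> {1..k}"
  using pebbling by (auto simp: pebbling_def)

lemma E_comparable: "(u, v) \<in> E \<Longrightarrow> (u, v) \<in> P\<^sup>* \<or> (v, u) \<in> P\<^sup>*"
  using pebbling by (auto simp: pebbling_def)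

lemma E_pebble: "(u, v) \<in> E \<Longrightarrow> (u, w) \<in> P\<^sup>* \<Longrightarrow> u \<noteq> w \<Longrightarrow> (w, v) \<in> P\<^sup>* \<Longrightarrow> p u \<noteq> p w"
  using pebbling by (auto simp: pebbling_def)

definition opts :: "'a option set" where
  "opts = insert None (Some ` V)"

fun kids :: "'a option \<Rightarrow> 'a set" where
  "kids None = tops V P"
| "kids (Some u) = {v. (u, v) \<in> P}"

text \<open>\<open>v\<close> itself belongs to \<open>pebbled (Some v)\<close>, by antisymmetry.
  Nothing is pebbled at the virtual root, so \<open>Prod None\<close> carries the whole graph
  without labels.\<close>

fun pebbled :: "'a option \<Rightarrow> 'a set" where
  "pebbled None = {}"
| "pebbled (Some v) = {u. (u, v) \<in> P\<^sup>* \<and> (\<forall>w. (u, w) \<in> P\<^sup>* \<and> u \<noteq> w \<and> (w, v) \<in> P\<^sup>* \<longrightarrow> p u \<noteq> p w)}"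

fun below :: "'a option \<Rightarrow> 'a set" where
  "below None = V"
| "below (Some v) = {u. (v, u) \<in> P\<^sup>*}"

text \<open>The partial inverse of \<open>p\<close> on the pebbled vertices; \<open>THE\<close> is
  justified by \<open>pebbled_inj\<close>.\<close>

definition pebble_label :: "'a option \<Rightarrow> nat \<rightharpoonup> 'a" where
  "pebble_label x l = (if \<exists>u\<in>pebbled x. p u = l then Some (THE u. u \<in> pebbled x \<and> p u = l) else None)"

definition induced :: "'a set \<Rightarrow> 'a pair_pre_digraph" where
  "induced W = \<lparr>pverts = W, parcs = E \<inter> W \<times> W\<rparr>"

fun node_graph :: "'a cnode \<Rightarrow> 'a labelled_graph" where
  "node_graph (Prod x) = \<lparr>graph_of = induced (pebbled x \<union> below x), labelling = pebble_label x\<rparr>"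
| "node_graph (Leaf x b) = \<lparr>graph_of = induced (pebbled x), labelling = pebble_label x\<rparr>"
| "node_graph (Elim v) = remove_label (p v)
     \<lparr>graph_of = induced (pebbled (Some v) \<union> below (Some v)), labelling = pebble_label (Some v)\<rparr>"

definition nodes :: "'a cnode set" where
  "nodes = Prod ` opts \<union> Elim ` V \<union> case_prod Leaf ` (opts \<times> UNIV)"

definition steps :: "'a cnode rel" where
  "steps = {(Prod x, Leaf x b) | x b. x \<in> opts} \<union> {(Elim v, Prod (Some v)) | v. v \<in> V} \<union>
     {(Prod x, Elim v) | x v. x \<in> opts \<and> v \<in> kids x}"

lemma kids_in_V: "x \<in> opts \<Longrightarrow> v \<in> kids x \<Longrightarrow> v \<in> V"
  using in_V by (cases x) (auto simp: tops_def)

lemma kids_unique: "v \<in> kids x \<Longrightarrow> v \<in> kids y \<Longrightarrow> x = y"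
  using parent_unique by (cases x; cases y) (auto simp: tops_def)

lemma kids_exist: "v \<in> V \<Longrightarrow> \<exists>x\<in>opts. v \<in> kids x"
  by (cases "v \<in> tops V P") (force simp: tops_def opts_def dest: in_V)+

lemma pebbled_subset: "x \<in> opts \<Longrightarrow> pebbled x \<subseteq> V"
  using rtrancl_in_V by (auto simp: opts_def)

lemma below_subset: "x \<in> opts \<Longrightarrow> below x \<subseteq> V"
  using rtrancl_in_V' by (auto simp: opts_def)

lemma self_pebbled: "v \<in> pebbled (Some v)"
  using antisym by auto

text \<open>Both vertices are ancestors of the same vertex, hence comparable, and the pebble of the
  upper one has not been moved to the lower one.\<close>

lemma pebbled_inj:
  assumes "u \<in> pebbled x" "w \<in> pebbled x" "p u = p w"
  shows "u = w"
proof (cases x)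
  case (Some v)
  then show ?thesis using assms ancestors_comparable[of u v w] by auto
qed (use assms in simp)

lemma pebble_label_iff: "pebble_label x l = Some u \<longleftrightarrow> u \<in> pebbled x \<and> p u = l"
proof -
  have "(THE u. u \<in> pebbled x \<and> p u = l) = u" if "u \<in> pebbled x" "p u = l" for u
    using that pebbled_inj by (intro the_equality) auto
  then show ?thesis unfolding pebble_label_def by (auto split: if_splits)
qed

text \<open>Since \<open>p\<close> is injective on pebbled vertices, removing the label
  \<open>p v\<close> unlabels \<open>v\<close> and no other vertex.\<close>

lemma elim_label_iff:
  "labelling (node_graph (Elim v)) l = Some u \<longleftrightarrow> u \<in> pebbled (Some v) - {v} \<and> p u = l"
proof -
  have "p u = p v \<longleftrightarrow> u = v" if "u \<in> pebbled (Some v)" for u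
    using pebbled_inj[OF that self_pebbled] by auto
  then show ?thesis by (auto simp: remove_label_def pebble_label_iff)
qed

lemma pebbled_kid: "v \<in> kids x \<Longrightarrow> pebbled (Some v) - {v} \<subseteq> pebbled x"
proof (cases x)
  case None
  then show "v \<in> kids x \<Longrightarrow> pebbled (Some v) - {v} \<subseteq> pebbled x"
    using top_ancestor[of v] by auto
next
  case (Some u)
  then show "pebbled (Some v) - {v} \<subseteq> pebbled x" if v: "v \<in> kids x"
    using v ancestor_step[of _ v u] by (auto intro: rtrancl_into_rtrancl)
qed

text \<open>Passing to the kids of \<open>Some u\<close> loses only \<open>u\<close>, which is
  pebbled there; passing to the kids of \<open>None\<close> loses nothing.\<close>

lemma below_split: "x \<in> opts \<Longrightarrow> pebbled x \<union> below x = pebbled x \<union> (\<Union>v\<in>kids x. below (Some v))"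
proof (cases x)
  case None
  then show ?thesis using top_above rtrancl_in_V' by (fastforce simp: tops_def)
next
  case (Some u)
  then have "below x = insert u (\<Union>v\<in>kids x. below (Some v))"
    by (auto elim: converse_rtranclE intro: converse_rtrancl_into_rtrancl)
  then show ?thesis using self_pebbled[of u] Some by auto
qed

lemma below_pebbled_disjoint:
  assumes "v \<in> kids x" "u \<in> below (Some v)"
  shows "u \<notin> pebbled x"
proof (cases x)
  case (Some y)
  have "(v, y) \<notin> P\<^sup>*" using assms Some no_back by auto
  then show ?thesis using assms Some by (auto intro: rtrancl_trans)
qed simp

lemma kids_incomparable:
  assumes "v \<in> kids x" "w \<in> kids x" "(v, w) \<in> P\<^sup>*"
  shows "v = w"
proof (cases x)
  case None
  then show ?thesis using assms top_ancestor by auto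
next
  case (Some y)
  then show ?thesis using assms ancestor_step[of v w y] no_back[of y v] by auto
qed

text \<open>An edge that leaves the subtree of \<open>v\<close> ends in a proper ancestor
  \<open>b\<close> of \<open>v\<close>. The pebble condition for this edge, applied to the vertices
  between \<open>b\<close> and \<open>v\<close>, says that the pebble of \<open>b\<close> is still
  in place at \<open>v\<close>.\<close>

lemma edge_below:
  assumes "v \<in> kids x" "a \<in> below (Some v)" "(a, b) \<in> E"
  shows "b \<in> pebbled (Some v) \<union> below (Some v)"
proof (cases "(v, b) \<in> P\<^sup>*")
  case False
  have va: "(v, a) \<in> P\<^sup>*" using assms by simp
  then have ba: "(b, a) \<in> P\<^sup>*"
    using E_comparable[OF assms(3)] False by (meson rtrancl_trans)
  then have "(b, v) \<in> P\<^sup>*" using ancestors_comparable[OF va] False by blast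
  moreover have "p b \<noteq> p w" if "(b, w) \<in> P\<^sup>*" "b \<noteq> w" "(w, v) \<in> P\<^sup>*" for w
    using E_pebble[OF E_sym[OF assms(3)], of w] that va by (meson rtrancl_trans)
  ultimately show ?thesis by auto
qed simp

text \<open>The renaming \<open>g\<close> is built in because the vertices of a product are tagged
  by the children, so renaming children changes the product itself. Two different children overlap
  only in vertices pebbled at \<open>x\<close>, which carry the same label in both.\<close>

lemma product_node:
  assumes x: "x \<in> opts" and M: "\<And>s. (Prod x, s) \<in> steps \<Longrightarrow> M (g s) = node_graph s"
  shows "labelled_iso (node_graph (Prod x)) (labelled_product (g ` {s. (Prod x, s) \<in> steps}) M)"
proof -
  let ?C = "{s. (Prod x, s) \<in> steps}"
  have C: "?C = range (Leaf x) \<union> Elim ` kids x" using x by (auto simp: steps_def)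
  have member: "\<exists>s\<in>?C. i = g s \<and> M i = node_graph s" if "i \<in> g ` ?C" for i
    using that M by blast
  have verts: "pverts (graph_of (node_graph (Leaf x b))) = pebbled x"
    "pverts (graph_of (node_graph (Elim v))) = pebbled (Some v) \<union> below (Some v)" for b v
    by (simp_all add: induced_def remove_label_def)
  have arcs: "parcs (graph_of (node_graph (Leaf x b))) = E \<inter> pebbled x \<times> pebbled x"
    "parcs (graph_of (node_graph (Elim v))) =
      E \<inter> (pebbled (Some v) \<union> below (Some v)) \<times> (pebbled (Some v) \<union> below (Some v))" for b v
    by (simp_all add: induced_def remove_label_def)
  have label: "u \<in> pebbled x \<and> p u = l" if "s \<in> ?C" "labelling (node_graph s) l = Some u" for s l u
    using that pebbled_kid[of _ x]
    by (auto simp: C pebble_label_iff elim_label_iff simp del: node_graph.simps(3) pebbled.simps) blast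
  have label_in: "labelling (node_graph s) (p u) = Some u"
    if s: "s \<in> ?C" and "u \<in> pverts (graph_of (node_graph s))" "u \<in> pebbled x" for s u
  proof -
    consider b where "s = Leaf x b" | v where "s = Elim v" "v \<in> kids x" using s unfolding C by blast
    then show ?thesis
    proof cases
      case 1
      then show ?thesis using that by (simp add: pebble_label_iff)
    next
      case 2
      then show ?thesis
        using that below_pebbled_disjoint[of v x] by (auto simp: verts elim_label_iff simp del: node_graph.simps)
    qed
  qed
  have disjoint: "u \<in> pebbled x"
    if st: "s \<in> ?C" "t \<in> ?C" "s \<noteq> t" and us: "u \<in> pverts (graph_of (node_graph s))"
      and ut: "u \<in> pverts (graph_of (node_graph t))" for s t u
  proof (rule ccontr)
    \<comment> \<open>A common vertex that is not pebbled at \<open>x\<close> would lie below two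
      different kids of \<open>x\<close>, and these are incomparable.\<close>
    assume u: "u \<notin> pebbled x"
    have "\<exists>v\<in>kids x. s = Elim v \<and> u \<in> below (Some v)"
      if "s \<in> ?C" "u \<in> pverts (graph_of (node_graph s))" for s
      using that u pebbled_kid[of _ x]
      by (auto simp: C verts simp del: node_graph.simps) blast+
    then obtain v w where "v \<in> kids x" "w \<in> kids x" "v \<noteq> w" "u \<in> below (Some v)" "u \<in> below (Some w)"
      using st us ut by blast
    then show False
      using ancestors_comparable[of v u w] kids_incomparable by auto
  qed
  show ?thesis
  proof (rule labelled_product_iso)
    fix i assume "i \<in> g ` ?C"
    then obtain s where s: "s \<in> ?C" "i = g s" "M i = node_graph s" using member by blast
    have "u \<in> pverts (graph_of (node_graph s))" if u: "labelling (node_graph s) l = Some u" for l u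
    proof -
      consider c where "s = Leaf x c" | v where "s = Elim v" using s(1) unfolding C by blast
      then show ?thesis
        using u by cases
          (auto simp: verts pebble_label_iff elim_label_iff induced_def simp del: node_graph.simps(3))
    qed
    then show "ran (labelling (M i)) \<subseteq> pverts (graph_of (M i))"
      unfolding s(3) by (auto simp: ran_def)
    show "parcs (graph_of (M i)) \<subseteq> pverts (graph_of (M i)) \<times> pverts (graph_of (M i))"
      using s(1) unfolding s(3) C by (auto simp: verts arcs simp del: node_graph.simps)
    fix j assume "j \<in> g ` ?C"
    then obtain t where t: "t \<in> ?C" "j = g t" "M j = node_graph t" using member by blast
    show "u = v" if "labelling (M i) l = Some u" "labelling (M j) l = Some v" for l u v
      using that label[OF s(1), of l u] label[OF t(1), of l v] pebbled_inj[of u x v]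
      unfolding s(3) t(3) by simp
    show "\<exists>l. labelling (M i) l = Some u \<and> labelling (M j) l = Some u"
      if "i \<noteq> j" "u \<in> pverts (graph_of (M i))" "u \<in> pverts (graph_of (M j))" for u
    proof -
      have "s \<noteq> t" using that(1) s(2) t(2) by blast
      then show ?thesis
        using that(2,3) disjoint[OF s(1) t(1), of u] label_in[OF s(1), of u] label_in[OF t(1), of u]
        unfolding s(3) t(3) by blast
    qed
  next
    have kids_verts: "pebbled (Some v) \<subseteq> pebbled x \<union> below (Some v)" if "v \<in> kids x" for v
      using pebbled_kid[OF that] by auto
    have "pebbled x \<union> below x = (\<Union>s\<in>?C. pverts (graph_of (node_graph s)))"
      using kids_verts unfolding below_split[OF x] C by (auto simp: verts simp del: node_graph.simps)
    also have "\<dots> = (\<Union>i\<in>g ` ?C. pverts (graph_of (M i)))" by (simp add: M)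
    finally show "pverts (graph_of (node_graph (Prod x))) = (\<Union>i\<in>g ` ?C. pverts (graph_of (M i)))"
      by (simp add: induced_def)
    have "E \<inter> (pebbled x \<union> below x) \<times> (pebbled x \<union> below x) =
        (\<Union>s\<in>?C. parcs (graph_of (node_graph s)))" (is "?L = ?R")
    proof (intro equalityI subrelI)
      fix a b assume ab: "(a, b) \<in> ?L"
      then have "(a, b) \<in> E" "(b, a) \<in> E" using E_sym by auto
      \<comment> \<open>If both ends are pebbled, the edge is in a leaf. Otherwise one end lies
        below some kid \<open>v\<close>, and \<open>edge_below\<close> puts the other end into the
        graph of \<open>Elim v\<close>.\<close>
      consider "a \<in> pebbled x" "b \<in> pebbled x" | v where "v \<in> kids x" "a \<in> below (Some v)"
        | v where "v \<in> kids x" "b \<in> below (Some v)"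
        using ab unfolding below_split[OF x] by blast
      then show "(a, b) \<in> ?R"
      proof cases
        case 1
        then show ?thesis using \<open>(a, b) \<in> E\<close> by (auto simp: C arcs simp del: node_graph.simps)
      next
        case 2
        then have "b \<in> pebbled (Some v) \<union> below (Some v)"
          using edge_below \<open>(a, b) \<in> E\<close> by blast
        then have "(a, b) \<in> parcs (graph_of (node_graph (Elim v)))"
          using 2 \<open>(a, b) \<in> E\<close> unfolding arcs by blast
        then show ?thesis using 2 unfolding C by blast
      next
        case 3
        then have "a \<in> pebbled (Some v) \<union> below (Some v)"
          using edge_below \<open>(b, a) \<in> E\<close> by blast
        then have "(a, b) \<in> parcs (graph_of (node_graph (Elim v)))"
          using 3 \<open>(a, b) \<in> E\<close> unfolding arcs by blast
        then show ?thesis using 3 unfolding C by blast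
      qed
    next
      fix a b assume "(a, b) \<in> ?R"
      then obtain s where "s \<in> ?C" and s: "(a, b) \<in> parcs (graph_of (node_graph s))" by blast
      then consider c where "s = Leaf x c" | v where "s = Elim v" "v \<in> kids x" unfolding C by blast
      then show "(a, b) \<in> ?L"
      proof cases
        case 1
        then show ?thesis using s unfolding 1 arcs by blast
      next
        case 2
        then have "pebbled (Some v) \<union> below (Some v) \<subseteq> pebbled x \<union> below x"
          using kids_verts[OF 2(2)] unfolding below_split[OF x] by blast
        then show ?thesis using s unfolding 2 arcs by blast
      qed
    qed
    also have "\<dots> = (\<Union>i\<in>g ` ?C. parcs (graph_of (M i)))" by (simp add: M)
    finally show "parcs (graph_of (node_graph (Prod x))) = (\<Union>i\<in>g ` ?C. parcs (graph_of (M i)))"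
      by (simp add: induced_def)
    show "labelling (node_graph (Prod x)) l = Some u \<longleftrightarrow>
        (\<exists>i\<in>g ` ?C. labelling (M i) l = Some u)" for l u
    proof -
      have "labelling (node_graph (Prod x)) l = Some u \<longleftrightarrow> (\<exists>s\<in>?C. labelling (node_graph s) l = Some u)"
      proof
        assume "labelling (node_graph (Prod x)) l = Some u"
        then have "labelling (node_graph (Leaf x True)) l = Some u" by simp
        moreover have "Leaf x True \<in> ?C" unfolding C by simp
        ultimately show "\<exists>s\<in>?C. labelling (node_graph s) l = Some u" by blast
      next
        assume "\<exists>s\<in>?C. labelling (node_graph s) l = Some u"
        then have "u \<in> pebbled x \<and> p u = l" using label by blast
        then show "labelling (node_graph (Prod x)) l = Some u" by (simp add: pebble_label_iff)
      qed
      then show ?thesis by (simp add: M)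
    qed
  qed
qed

lemma branching_nodes: "branching nodes steps"
proof
  show "finite nodes" using finite_V by (simp add: nodes_def opts_def)
  show "steps \<subseteq> nodes \<times> nodes"
  proof (rule subrelI)
    fix s t assume "(s, t) \<in> steps"
    then consider x b where "s = Prod x" "t = Leaf x b" "x \<in> opts"
      | v where "s = Elim v" "t = Prod (Some v)" "v \<in> V"
      | x v where "s = Prod x" "t = Elim v" "x \<in> opts" "v \<in> V"
      using kids_in_V unfolding steps_def by blast
    then show "(s, t) \<in> nodes \<times> nodes" by cases (auto simp: nodes_def opts_def)
  qed
  show "s = s'" if "(s, t) \<in> steps" "(s', t) \<in> steps" for s s' t
    using that kids_unique by (auto simp: steps_def)
  \<comment> \<open>Each forest vertex contributes two ranks, for \<open>Elim v\<close> and then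
    \<open>Prod (Some v)\<close>, with leaves one rank after their product node. A kid has level one
    larger, so its \<open>2 * level v + 1\<close> exceeds the rank of the product node above
    it.\<close>
  let ?rank = "\<lambda>s. case s of Prod x \<Rightarrow> (case x of None \<Rightarrow> 0 | Some v \<Rightarrow> 2 * level v + 2)
    | Elim v \<Rightarrow> 2 * level v + 1 | Leaf x b \<Rightarrow> (case x of None \<Rightarrow> 1 | Some v \<Rightarrow> 2 * level v + 3)"
  show "acyclic steps"
  proof (rule acyclic_rank[where f = ?rank])
    fix s t assume "(s, t) \<in> steps"
    then consider x b where "s = Prod x" "t = Leaf x b" | v where "s = Elim v" "t = Prod (Some v)"
      | x v where "s = Prod x" "t = Elim v" "v \<in> kids x"
      by (auto simp: steps_def)
    then show "?rank s < ?rank t"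
      by cases (auto split: option.splits simp: level_step)
  qed
qed

lemma tops_nodes: "tops nodes steps = {Prod None}"
proof -
  have "\<exists>s. (s, t) \<in> steps" if "t \<in> nodes" "t \<noteq> Prod None" for t
  proof (cases t)
    case (Elim v)
    then show ?thesis using that kids_exist[of v] by (auto simp: nodes_def steps_def)
  qed (use that in \<open>auto simp: nodes_def steps_def opts_def\<close>)
  moreover have "(s, Prod None) \<notin> steps" for s by (auto simp: steps_def)
  moreover have "Prod None \<in> nodes" by (simp add: nodes_def opts_def)
  ultimately show ?thesis unfolding tops_def by blast
qed

text \<open>Elimination nodes above a node belonging to \<open>u\<close> come from ancestors of
  \<open>u\<close>; this is how the forest depth bounds the elimination depth.\<close>

lemma eliminated_ancestor:
  assumes "(Elim v, t) \<in> steps\<^sup>*"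
  shows "\<exists>u. (v, u) \<in> P\<^sup>* \<and> (t = Elim u \<or> t = Prod (Some u) \<or> (\<exists>b. t = Leaf (Some u) b))"
  using assms
proof (induction rule: rtrancl_induct)
  case (step s t)
  then show ?case by (auto simp: steps_def intro: rtrancl_into_rtrancl)
qed auto

lemma single_child:
assumes "s \<in> nodes" "card {c. (s, c) \<in> steps} = 1"
shows "s \<in> Elim ` V"
proof -
  obtain c where c: "{c. (s, c) \<in> steps} = {c}" using assms(2) by (auto simp: card_1_singleton_iff)
  have "s \<noteq> Prod x" for x
  proof
    assume "s = Prod x"
    then have "Leaf x True \<in> {c. (s, c) \<in> steps}" "Leaf x False \<in> {c. (s, c) \<in> steps}"
      using assms(1) by (auto simp: nodes_def steps_def)
    then show False unfolding c by auto
  qed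
  moreover have "s \<noteq> Leaf x b" for x b using c by (auto simp: steps_def)
  ultimately show ?thesis using assms(1) by (auto simp: nodes_def)
qed

lemma node_elimination_depth:
  assumes "\<And>v. v \<in> V \<Longrightarrow> card {u. (u, v) \<in> P\<^sup>*} \<le> q" "t \<in> nodes"
  shows "card {s. (s, t) \<in> steps\<^sup>* \<and> card {c. (s, c) \<in> steps} = 1} \<le> q"
proof -
  interpret N: branching nodes steps by (rule branching_nodes)
  have sub: "{s. (s, t) \<in> steps\<^sup>* \<and> card {c. (s, c) \<in> steps} = 1} \<subseteq> {Elim v | v. (Elim v, t) \<in> steps\<^sup>*}"
    using single_child N.rtrancl_in_V assms(2) by blast
  show ?thesis
  proof (cases "\<exists>v. (Elim v, t) \<in> steps\<^sup>*")
    case False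
    then have empty: "{s. (s, t) \<in> steps\<^sup>* \<and> card {c. (s, c) \<in> steps} = 1} = {}" using sub by blast
    show ?thesis unfolding empty by simp
  next
    case True
    then obtain u where u: "t = Elim u \<or> t = Prod (Some u) \<or> (\<exists>b. t = Leaf (Some u) b)"
      using eliminated_ancestor by blast
    then have "u \<in> V" using assms(2) by (auto simp: nodes_def opts_def)
    have "(v, u) \<in> P\<^sup>*" if "(Elim v, t) \<in> steps\<^sup>*" for v
      using eliminated_ancestor[OF that] u by auto
    then have "{s. (s, t) \<in> steps\<^sup>* \<and> card {c. (s, c) \<in> steps} = 1} \<subseteq> Elim ` {v. (v, u) \<in> P\<^sup>*}"
      using sub by blast
    then have "card {s. (s, t) \<in> steps\<^sup>* \<and> card {c. (s, c) \<in> steps} = 1} \<le> card {v. (v, u) \<in> P\<^sup>*}"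
      using finite_ancestors by (rule surj_card_le[rotated])
    then show ?thesis using assms(1)[OF \<open>u \<in> V\<close>] by linarith
  qed
qed

lemma k_labelled_node:
  assumes "t \<in> nodes"
  shows "k_labelled k (node_graph t)"
proof -
  have graph: "pair_graph (induced W)" if "W \<subseteq> V" for W
    using that E_sym E_irrefl finite_V finite_subset[OF that] finite_subset[of "E \<inter> W \<times> W" "W \<times> W"]
    by unfold_locales (auto simp: induced_def symmetric_def sym_def)
  have label: "dom (pebble_label x) \<subseteq> {1..k}" "ran (pebble_label x) = pebbled x" if "x \<in> opts" for x
    using pebbled_subset[OF that] p_range by (auto simp: ran_def pebble_label_iff)
  have sub: "ran (m(l := None)) \<subseteq> ran m" "dom (m(l := None)) \<subseteq> dom m" for m :: "nat \<rightharpoonup> 'a" and l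
    by (auto simp: ran_def)
  show ?thesis
  proof (cases t)
    case (Elim v)
    then have v: "Some v \<in> opts" using assms by (auto simp: nodes_def opts_def)
    then show ?thesis
      using Elim graph[of "pebbled (Some v) \<union> below (Some v)"] label[OF v] pebbled_subset[OF v]
        below_subset[OF v] sub[of "pebble_label (Some v)" "p v"]
      by (auto simp: k_labelled_def remove_label_def induced_def simp del: pebbled.simps below.simps)
  next
    case (Prod x)
    then have "x \<in> opts" using assms by (auto simp: nodes_def)
    then show ?thesis
      using Prod graph pebbled_subset below_subset label by (auto simp: k_labelled_def induced_def)
  next
    case (Leaf x b)
    then have "x \<in> opts" using assms by (auto simp: nodes_def)
    then show ?thesis
      using Leaf graph pebbled_subset label by (auto simp: k_labelled_def induced_def)
  qed
qed

end

text \<open>Graph vertices and tree nodes have to be natural numbers. Hence two renamings: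
  \<open>f\<close> moves the graph before the tree is built, \<open>g\<close> moves the nodes of the
  finished tree.\<close>

lemma pebbling_imp_construction_tree:
  fixes G :: "'a pair_pre_digraph"
  assumes "pair_graph G" "branching (pverts G) P" "pebbling k (pverts G) (parcs G) P p"
    and depth: "\<And>v. v \<in> pverts G \<Longrightarrow> card {u. (u, v) \<in> P\<^sup>*} \<le> q"
  shows "\<exists>(T :: nat pair_pre_digraph) r (\<Lambda> :: nat \<Rightarrow> nat labelled_graph).
    construction_tree k (unlabelled G) T r \<Lambda> \<and> elimination_depth T r \<le> q"
proof -
  interpret G: pair_graph G by fact
  interpret B: branching "pverts G" P by fact
  obtain f :: "'a \<Rightarrow> nat" where f: "inj_on f (pverts G)"
    using finite_imp_inj_to_nat_seg[OF B.finite_V] by blast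
  define V' where "V' = f ` pverts G"
  define E' where "E' = map_prod f f ` parcs G"
  define P' where "P' = map_prod f f ` P"
  have sub: "parcs G \<subseteq> pverts G \<times> pverts G" using G.in_arcsD1 G.in_arcsD2 by auto
  interpret B': branching V' P' unfolding V'_def P'_def using B.branching_image[OF f] .
  interpret C: pebble_cover V' P' k E' "p \<circ> inv_into (pverts G) f"
  proof
    show "pebbling k V' E' P' (p \<circ> inv_into (pverts G) f)"
      unfolding V'_def E'_def P'_def by (rule pebbling_image) fact+
    show "E' \<subseteq> V' \<times> V'" using sub by (auto simp: E'_def V'_def)
    show "(v, u) \<in> E'" if "(u, v) \<in> E'" for u v
      using that G.arcs_symmetric by (force simp: E'_def)
    show "(u, u) \<notin> E'" for u
    proof
      assume "(u, u) \<in> E'"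
      then obtain a b where ab: "(a, b) \<in> parcs G" "f a = f b" by (auto simp: E'_def)
      then have "a = b" using sub f by (blast dest: inj_onD)
      then show False using ab G.no_loops' by blast
    qed
  qed
  interpret N: branching C.nodes C.steps by (rule C.branching_nodes)
  obtain g :: "nat cnode \<Rightarrow> nat" where g: "inj_on g C.nodes"
    using finite_imp_inj_to_nat_seg[OF N.finite_V] by blast
  define D where "D = map_prod g g ` C.steps"
  interpret I: branching "g ` C.nodes" D unfolding D_def using N.branching_image[OF g] .
  define \<Lambda> where "\<Lambda> = C.node_graph \<circ> inv_into C.nodes g"
  define r where "r = g (Prod None)"
  have \<Lambda>: "\<Lambda> (g t) = C.node_graph t" if "t \<in> C.nodes" for t using that g by (simp add: \<Lambda>_def)
  have tops: "tops (g ` C.nodes) D = {r}"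
    using N.tops_image[OF g] by (simp add: D_def r_def C.tops_nodes)
  have children: "{s. (g t, s) \<in> D} = g ` {s. (t, s) \<in> C.steps}" if "t \<in> C.nodes" for t
    unfolding D_def using N.image_children[OF g that] .
  have card_children: "card {s. (g t, s) \<in> D} = card {s. (t, s) \<in> C.steps}" if "t \<in> C.nodes" for t
    unfolding children[OF that] using g N.in_V by (intro card_image inj_on_subset[OF g]) auto
  have root: "labelled_iso (\<Lambda> r) (unlabelled G)"
  proof -
    let ?f = "inv_into (pverts G) f"
    have "Prod None \<in> C.nodes" by (simp add: C.nodes_def C.opts_def)
    then have "graph_of (\<Lambda> r) = \<lparr>pverts = V', parcs = E'\<rparr>" "labelling (\<Lambda> r) = Map.empty"
      using \<Lambda> C.E_subset by (auto simp: r_def C.induced_def C.pebble_label_def)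
    moreover have "bij_betw ?f V' (pverts G)"
      unfolding V'_def using f by (intro bij_betw_inv_into inj_on_imp_bij_betw)
    moreover have "map_prod ?f ?f ` E' = parcs G"
    proof -
      have "map_prod ?f ?f (map_prod f f e) = e" if "e \<in> parcs G" for e
        using that f sub by (cases e) auto
      then show ?thesis unfolding E'_def image_image by force
    qed
    ultimately show ?thesis
      unfolding labelled_iso_def unlabelled_def by (intro exI[of _ ?f]) auto
  qed
  have iso_refl: "labelled_iso L L" for L :: "nat labelled_graph"
    unfolding labelled_iso_def by (intro exI[of _ id]) (auto simp: option.map_id prod.map_id0)
  have "construction_tree k (unlabelled G) (branching_graph (g ` C.nodes) D) r \<Lambda>"
    unfolding I.construction_tree_iff[OF tops]
  proof (intro conjI ballI root allI impI)
    fix n assume "n \<in> g ` C.nodes"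
    then obtain t where t: "t \<in> C.nodes" "n = g t" by blast
    show "k_labelled k (\<Lambda> n)" using t by (simp add: \<Lambda> C.k_labelled_node)
    show "fully_labelled (\<Lambda> n)" if "{s. (n, s) \<in> D} = {}"
    proof -
      have none: "{s. (t, s) \<in> C.steps} = {}" using that children[OF t(1)] t(2) by simp
      have "(t, Leaf x True) \<in> C.steps" if "t = Prod x" for x
        using that t(1) by (auto simp: C.steps_def C.nodes_def)
      moreover have "(t, Prod (Some v)) \<in> C.steps" if "t = Elim v" for v
        using that t(1) by (auto simp: C.steps_def C.nodes_def)
      ultimately have "t \<noteq> Prod x" "t \<noteq> Elim v" for x v using none by blast+
      then obtain x b where "t = Leaf x b" by (cases t) auto
      then show ?thesis using t
        by (auto simp: \<Lambda> fully_labelled_def C.induced_def ran_def C.pebble_label_iff)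
    qed
    show "\<exists>l\<in>dom (labelling (\<Lambda> n')). labelled_iso (\<Lambda> n) (remove_label l (\<Lambda> n'))"
      if "{s. (n, s) \<in> D} = {n'}" for n'
    proof -
      have one: "card {s. (t, s) \<in> C.steps} = 1" using that card_children[OF t(1)] t(2) by simp
      obtain v where v: "t = Elim v" "v \<in> V'" using C.single_child[OF t(1) one] by blast
      then have "{s. (t, s) \<in> C.steps} = {Prod (Some v)}" by (auto simp: C.steps_def)
      then have n': "n' = g (Prod (Some v))" using that children[OF t(1)] t(2) by simp
      have nodes: "Prod (Some v) \<in> C.nodes" using v by (auto simp: C.nodes_def C.opts_def)
      let ?l = "(p \<circ> inv_into (pverts G) f) v"
      have "C.pebble_label (Some v) ?l = Some v"
        using C.self_pebbled by (simp add: C.pebble_label_iff del: C.pebbled.simps)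
      then have "?l \<in> dom (labelling (\<Lambda> n'))" using nodes by (auto simp: n' \<Lambda>)
      \<comment> \<open>The equality is literal, because \<open>Elim v\<close> is defined by this
        label removal; a reflexive isomorphism suffices.\<close>
      moreover have "\<Lambda> n = remove_label ?l (\<Lambda> n')" using t v nodes by (simp add: n' \<Lambda>)
      ultimately show ?thesis using iso_refl by metis
    qed
    show "labelled_iso (\<Lambda> n) (labelled_product {s. (n, s) \<in> D} \<Lambda>)" if "card {s. (n, s) \<in> D} > 1"
    proof -
      have "1 < card {s. (t, s) \<in> C.steps}" using that card_children[OF t(1)] t(2) by simp
      then have "\<not> {s. (t, s) \<in> C.steps} \<subseteq> {s}" for s
        using card_mono[of "{s}" "{s. (t, s) \<in> C.steps}"] by auto
      moreover have "{s. (Elim v, s) \<in> C.steps} \<subseteq> {Prod (Some v)}"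
        "{s. (Leaf x b, s) \<in> C.steps} \<subseteq> {Leaf x b}" for v x b
        by (auto simp: C.steps_def)
      ultimately obtain x where x: "t = Prod x" by (cases t) blast+
      then have opts: "x \<in> C.opts" using t(1) by (auto simp: C.nodes_def)
      have "labelled_iso (C.node_graph (Prod x)) (labelled_product (g ` {s. (Prod x, s) \<in> C.steps}) \<Lambda>)"
        using opts \<Lambda> N.in_V by (intro C.product_node) blast+
      then show ?thesis using t x by (simp add: \<Lambda> children)
    qed
  qed
  moreover have "elimination_depth (branching_graph (g ` C.nodes) D) r \<le> q"
    unfolding I.elimination_depth_le_iff[OF tops]
  proof
    have depth': "card {u. (u, v) \<in> P'\<^sup>*} \<le> q" if v: "v \<in> V'" for v
    proof -
      obtain a where a: "a \<in> pverts G" "v = f a" using v by (auto simp: V'_def)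
      then have "{u. (u, v) \<in> P'\<^sup>*} = f ` {u. (u, a) \<in> P\<^sup>*}"
        using B.image_ancestors[OF f] by (simp add: P'_def)
      then show ?thesis using card_image_le[OF B.finite_ancestors, of f a] depth[OF a(1)] by simp
    qed
    fix n assume "n \<in> g ` C.nodes"
    then obtain t where t: "t \<in> C.nodes" "n = g t" by blast
    let ?A = "{s. (s, t) \<in> C.steps\<^sup>* \<and> card {c. (s, c) \<in> C.steps} = 1}"
    have "{s. (s, n) \<in> D\<^sup>*} = g ` {s. (s, t) \<in> C.steps\<^sup>*}"
      unfolding D_def t(2) using N.image_ancestors[OF g t(1)] .
    then have origin: "\<exists>s. x = g s \<and> (s, t) \<in> C.steps\<^sup>*" if "(x, n) \<in> D\<^sup>*" for x
      using that by blast
    have "{s. (s, n) \<in> D\<^sup>* \<and> card {c. (s, c) \<in> D} = 1} \<subseteq> g ` ?A"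
    proof clarify
      fix x assume x: "(x, n) \<in> D\<^sup>*" "card {c. (x, c) \<in> D} = 1"
      then obtain s where s: "x = g s" "(s, t) \<in> C.steps\<^sup>*" using origin by blast
      then have "card {c. (s, c) \<in> C.steps} = 1"
        using x(2) card_children N.rtrancl_in_V t(1) by metis
      then show "x \<in> g ` ?A" using s by blast
    qed
    moreover have "finite ?A" using N.finite_ancestors[of t] by (auto intro: finite_subset)
    ultimately have "card {s. (s, n) \<in> D\<^sup>* \<and> card {c. (s, c) \<in> D} = 1} \<le> card ?A"
      by (rule surj_card_le[rotated])
    also have "\<dots> \<le> q" using C.node_elimination_depth[OF depth' t(1)] .
    finally show "card {s. (s, n) \<in> D\<^sup>* \<and> card {c. (s, c) \<in> D} = 1} \<le> q" .
  qed
  ultimately show ?thesis by blast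
qed

section \<open>From construction trees to tree decompositions\<close>

text \<open>\<open>h t\<close> composes \<open>h0\<close> with the maps \<open>up\<close> along the
  path from \<open>t\<close> to the root. The first argument of \<open>H\<close> counts the arcs
  still to be climbed.\<close>

lemma (in branching) path_composition:
  fixes up :: "'a \<Rightarrow> 'b \<Rightarrow> 'b" and h0 :: "'b \<Rightarrow> 'c"
  assumes "tops V P = {r}"
  shows "\<exists>h. h r = h0 \<and> (\<forall>(t, s)\<in>P. \<forall>u. h s u = h t (up s u))"
proof -
  define par where "par s = (THE t. (t, s) \<in> P)" for s
  have par: "par s = t" if "(t, s) \<in> P" for t s
    unfolding par_def using that parent_unique by (intro the_equality) auto
  define H where "H = rec_nat (\<lambda>_. h0) (\<lambda>_ h t u. h (par t) (up t u))"
  have H: "H 0 = (\<lambda>_. h0)" "\<And>n t u. H (Suc n) t u = H n (par t) (up t u)" by (simp_all add: H_def)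
  have "{u. (u, r) \<in> P\<^sup>*} = {r}" using top_ancestor[of r] assms by auto
  then have "level r = 1" by (simp add: level_def)
  moreover have "level t - 1 + 1 = level t" for t
  proof -
    have "t \<in> {u. (u, t) \<in> P\<^sup>*}" by simp
    then have "level t \<noteq> 0" unfolding level_def using finite_ancestors by auto
    then show ?thesis by simp
  qed
  then have "level s - 1 = Suc (level t - 1)" if "(t, s) \<in> P" for t s
    using level_step[OF that] by (metis Suc_eq_plus1 diff_Suc_1)
  \<comment> \<open>The root has level 1, so \<open>level t - 1\<close> arcs lead from
    \<open>t\<close> up to it.\<close>
  ultimately show ?thesis
    using H par by (intro exI[of _ "\<lambda>t. H (level t - 1) t"]) auto
qed

text \<open>What an isomorphism with a product and one with a label removal have in common, phrased
  by maps from the children into the parent. Injectivity is required only over unlabelled vertices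
  of \<open>L\<close>, since labelled ones may be merged. Whether a labelled vertex stays labelled
  is left open, as an elimination may end its labelling.\<close>

definition gluing_maps ::
  "'i set \<Rightarrow> 'b labelled_graph \<Rightarrow> ('i \<Rightarrow> 'b labelled_graph) \<Rightarrow> ('i \<Rightarrow> 'b \<Rightarrow> 'b) \<Rightarrow> bool" where
  "gluing_maps I L M g \<longleftrightarrow>
     (\<forall>i\<in>I. g i ` pverts (graph_of (M i)) \<subseteq> pverts (graph_of L)) \<and>
     (\<forall>i\<in>I. \<forall>u\<in>pverts (graph_of (M i)) - ran (labelling (M i)). g i u \<notin> ran (labelling L)) \<and>
     (\<forall>w\<in>pverts (graph_of L) - ran (labelling L). \<exists>i\<in>I. \<exists>u\<in>pverts (graph_of (M i)). g i u = w) \<and>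
     (\<forall>i\<in>I. \<forall>j\<in>I. \<forall>u\<in>pverts (graph_of (M i)). \<forall>v\<in>pverts (graph_of (M j)).
        g i u = g j v \<longrightarrow> g i u \<notin> ran (labelling L) \<longrightarrow> i = j \<and> u = v) \<and>
     (\<forall>(x, y)\<in>parcs (graph_of L). \<exists>i\<in>I. \<exists>(u, v)\<in>parcs (graph_of (M i)). g i u = x \<and> g i v = y)"

text \<open>A vertex without a label is glued to nothing, so its class is a singleton. This gives
  injectivity over unlabelled vertices and makes a class labelled exactly when its members
  are.\<close>

lemma product_gluing_maps:
  assumes iso: "labelled_iso L (labelled_product I M)"
    and ranL: "ran (labelling L) \<subseteq> pverts (graph_of L)"
    and arcsL: "parcs (graph_of L) \<subseteq> pverts (graph_of L) \<times> pverts (graph_of L)"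
    and ranM: "\<And>i. i \<in> I \<Longrightarrow> ran (labelling (M i)) \<subseteq> pverts (graph_of (M i))"
  shows "\<exists>g. gluing_maps I L M g \<and> (\<forall>i\<in>I. g i ` ran (labelling (M i)) \<subseteq> ran (labelling L))"
proof -
  let ?c = "glue_class I M"
  let ?Q = "labelled_product I M"
  obtain f where f: "bij_betw f (pverts (graph_of L)) (pverts (graph_of ?Q))"
    and farcs: "parcs (graph_of ?Q) = map_prod f f ` parcs (graph_of L)"
    and flab: "labelling ?Q = (\<lambda>l. map_option f (labelling L l))"
    using iso unfolding labelled_iso_def by blast
  have inj: "inj_on f (pverts (graph_of L))" using f by (simp add: bij_betw_def)
  have sym: "(glue I M)\<inverse> \<subseteq> glue I M" by (auto simp: glue_def)
  have self: "(i, u) \<in> ?c i u" for i u by (simp add: glue_class_def)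
  have class_eq: "?c i u = ?c j v" if "((i, u), (j, v)) \<in> glue I M" for i u j v
  proof -
    have "((j, v), (i, u)) \<in> (glue I M)\<^sup>*" using that sym by blast
    then show ?thesis using that unfolding glue_class_def by (auto intro: rtrancl_trans)
  qed
  have unlabelled: "?c i u = {(i, u)}" if "u \<notin> ran (labelling (M i))" for i u
  proof -
    have "((i, u), z) \<notin> glue I M" for z using that by (auto simp: glue_def ran_def)
    then show ?thesis by (auto simp: glue_class_def elim: converse_rtranclE)
  qed
  have Qlab: "labelling ?Q l = Some (?c i u)" if "i \<in> I" "labelling (M i) l = Some u" for i l u
  proof -
    have "(THE c. \<exists>i\<in>I. \<exists>u. labelling (M i) l = Some u \<and> c = ?c i u) = ?c i u"
    proof (rule the_equality)
      show "\<exists>j\<in>I. \<exists>v. labelling (M j) l = Some v \<and> ?c i u = ?c j v" using that by blast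
    next
      fix c assume "\<exists>i\<in>I. \<exists>u. labelling (M i) l = Some u \<and> c = ?c i u"
      then obtain j v where "j \<in> I" "labelling (M j) l = Some v" "c = ?c j v" by blast
      then show "c = ?c i u" using that by (auto intro!: class_eq simp: glue_def)
    qed
    then show ?thesis using that by (auto simp: labelled_product_def)
  qed
  have Qlab_origin: "\<exists>i\<in>I. \<exists>u\<in>ran (labelling (M i)). c = ?c i u" if c: "c \<in> ran (labelling ?Q)" for c
  proof -
    obtain l where l: "labelling ?Q l = Some c" using c by (auto simp: ran_def)
    then obtain i u where "i \<in> I" "labelling (M i) l = Some u"
      by (auto simp: labelled_product_def split: if_splits)
    moreover from this have "c = ?c i u" using Qlab l by simp
    ultimately show ?thesis by (auto simp: ran_def)
  qed
  have lab_iff: "w \<in> ran (labelling L) \<longleftrightarrow> f w \<in> ran (labelling ?Q)" if w: "w \<in> pverts (graph_of L)" for w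
  proof
    assume "f w \<in> ran (labelling ?Q)"
    then obtain w' where "w' \<in> ran (labelling L)" "f w' = f w" unfolding flab by (auto simp: ran_def)
    then show "w \<in> ran (labelling L)" using inj w ranL by (metis inj_onD subsetD)
  qed (auto simp: flab ran_def)
  define g where "g i u = inv_into (pverts (graph_of L)) f (?c i u)" for i u
  have class_in: "?c i u \<in> pverts (graph_of ?Q)" if "i \<in> I" "u \<in> pverts (graph_of (M i))" for i u
    using that by (auto simp: labelled_product_def)
  have g: "g i u \<in> pverts (graph_of L)" "f (g i u) = ?c i u"
    if "i \<in> I" "u \<in> pverts (graph_of (M i))" for i u
  proof -
    have "?c i u \<in> f ` pverts (graph_of L)" using class_in[OF that] f by (simp add: bij_betw_def)
    then show "g i u \<in> pverts (graph_of L)" "f (g i u) = ?c i u"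
      unfolding g_def by (rule inv_into_into, rule f_inv_into_f)
  qed
  have g_eq: "g i u = w" if "i \<in> I" "u \<in> pverts (graph_of (M i))" "w \<in> pverts (graph_of L)" "?c i u = f w"
    for i u w
    using g[OF that(1,2)] that(3,4) inj by (metis inj_onD)
  have unlab: "g i u \<notin> ran (labelling L) \<longleftrightarrow> u \<notin> ran (labelling (M i))"
    if iu: "i \<in> I" "u \<in> pverts (graph_of (M i))" for i u
  proof -
    have "u \<in> ran (labelling (M i)) \<longleftrightarrow> ?c i u \<in> ran (labelling ?Q)"
    proof
      assume "?c i u \<in> ran (labelling ?Q)"
      then obtain j v where "j \<in> I" "v \<in> ran (labelling (M j))" "?c i u = ?c j v"
        using Qlab_origin by blast
      \<comment> \<open>Were \<open>u\<close> unlabelled, its class would be a singleton, and the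
        labelled \<open>(j, v)\<close> would be \<open>(i, u)\<close>.\<close>
      then have "(j, v) \<in> ?c i u" "v \<in> ran (labelling (M j))" using self[of j v] by simp_all
      then show "u \<in> ran (labelling (M i))" using unlabelled[of u i]
        by (cases "u \<in> ran (labelling (M i))") auto
    qed (use Qlab iu in \<open>auto simp: ran_def\<close>)
    then show ?thesis using lab_iff[of "g i u"] g[OF iu] by simp
  qed
  have "gluing_maps I L M g"
    unfolding gluing_maps_def
  proof (intro conjI ballI impI)
    show "g i ` pverts (graph_of (M i)) \<subseteq> pverts (graph_of L)" if "i \<in> I" for i using g that by auto
    show "g i u \<notin> ran (labelling L)" if "i \<in> I" "u \<in> pverts (graph_of (M i)) - ran (labelling (M i))"
      for i u using that unlab by auto
    show "\<exists>i\<in>I. \<exists>u\<in>pverts (graph_of (M i)). g i u = w"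
      if w: "w \<in> pverts (graph_of L) - ran (labelling L)" for w
    proof -
      have "f w \<in> pverts (graph_of ?Q)" using w f by (auto simp: bij_betw_def)
      then obtain i u where "i \<in> I" "u \<in> pverts (graph_of (M i))" "?c i u = f w"
        by (auto simp: labelled_product_def)
      then show ?thesis using g_eq w by blast
    qed
    show "i = j" "u = v"
      if "i \<in> I" "j \<in> I" "u \<in> pverts (graph_of (M i))" "v \<in> pverts (graph_of (M j))" "g i u = g j v"
        "g i u \<notin> ran (labelling L)" for i j u v
    proof -
      have "?c i u = ?c j v" using g(2) that by metis
      then have "(j, v) \<in> ?c i u" using self by simp
      moreover have "u \<notin> ran (labelling (M i))" using unlab[of i u] that by blast
      ultimately have "(j, v) \<in> {(i, u)}" using unlabelled by simp
      then show "i = j" "u = v" by simp_all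
    qed
    show "case e of (x, y) \<Rightarrow> \<exists>i\<in>I. \<exists>(u, v)\<in>parcs (graph_of (M i)). g i u = x \<and> g i v = y"
      if e: "e \<in> parcs (graph_of L)" for e
    proof -
      obtain x y where xy: "e = (x, y)" "x \<in> pverts (graph_of L)" "y \<in> pverts (graph_of L)"
        using e arcsL by auto
      have "(f x, f y) \<in> parcs (graph_of ?Q)" using e farcs xy by force
      then obtain i u v where "i \<in> I" "(u, v) \<in> parcs (graph_of (M i))" "?c i u = f x" "?c i v = f y"
        by (auto simp: labelled_product_def)
      then have "g i u = x" "g i v = y"
        using xy inj by (simp_all add: g_def)
      then show ?thesis using \<open>i \<in> I\<close> \<open>(u, v) \<in> _\<close> xy by auto
    qed
  qed
  moreover have "g i ` ran (labelling (M i)) \<subseteq> ran (labelling L)" if "i \<in> I" for i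
    using unlab[OF that] ranM[OF that] by auto
  ultimately show ?thesis by blast
qed

text \<open>Removing a label keeps the graph, so the isomorphism read backwards is a gluing map.
  Only the vertex that carried \<open>l\<close> can lose its last label.\<close>

lemma elimination_gluing_maps:
  assumes iso: "labelled_iso L (remove_label l (M i))"
    and ranL: "ran (labelling L) \<subseteq> pverts (graph_of L)"
    and ranM: "ran (labelling (M i)) \<subseteq> pverts (graph_of (M i))"
    and arcsL: "parcs (graph_of L) \<subseteq> pverts (graph_of L) \<times> pverts (graph_of L)"
  shows "\<exists>g. gluing_maps {i} L M g \<and> (\<exists>x. g i ` ran (labelling (M i)) \<subseteq> insert x (ran (labelling L)))"
proof -
  obtain f where f: "bij_betw f (pverts (graph_of L)) (pverts (graph_of (M i)))"
    and farcs: "parcs (graph_of (M i)) = map_prod f f ` parcs (graph_of L)"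
    and flab: "(labelling (M i))(l := None) = (\<lambda>l. map_option f (labelling L l))"
    using iso unfolding labelled_iso_def by (auto simp: remove_label_def)
  have inj: "inj_on f (pverts (graph_of L))" using f by (simp add: bij_betw_def)
  define h where "h = inv_into (pverts (graph_of L)) f"
  have h: "h u \<in> pverts (graph_of L)" "f (h u) = u" if "u \<in> pverts (graph_of (M i))" for u
    using that f unfolding h_def bij_betw_def by (auto intro: inv_into_into f_inv_into_f)
  have hf: "h (f w) = w" if "w \<in> pverts (graph_of L)" for w
    using that inj by (simp add: h_def)
  have lab: "f w \<in> ran (labelling (M i))" if w: "w \<in> ran (labelling L)" for w
  proof -
    obtain m where "labelling L m = Some w" using w by (auto simp: ran_def)
    then have "((labelling (M i))(l := None)) m = Some (f w)" using flab by simp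
    then show ?thesis by (auto simp: ran_def split: if_splits)
  qed
  have lab': "h u \<in> ran (labelling L)" if u: "labelling (M i) m = Some u" "m \<noteq> l" for m u
  proof -
    have "map_option f (labelling L m) = Some u" using fun_cong[OF flab, of m] u by simp
    then obtain w where "labelling L m = Some w" "u = f w" by auto
    moreover from this have "w \<in> pverts (graph_of L)" using ranL by (auto simp: ran_def)
    ultimately show ?thesis using hf by (auto simp: ran_def)
  qed
  have "gluing_maps {i} L M (\<lambda>_. h)"
    unfolding gluing_maps_def
  proof (intro conjI ballI impI)
    show "h ` pverts (graph_of (M j)) \<subseteq> pverts (graph_of L)" if "j \<in> {i}" for j
      using that h by auto
    show "h u \<notin> ran (labelling L)"
      if "j \<in> {i}" "u \<in> pverts (graph_of (M j)) - ran (labelling (M j))" for j u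
      using that h lab[of "h u"] by auto
    show "\<exists>j\<in>{i}. \<exists>u\<in>pverts (graph_of (M j)). h u = w"
      if "w \<in> pverts (graph_of L) - ran (labelling L)" for w
      using that hf f by (auto simp: bij_betw_def)
    show "j = j'" if "j \<in> {i}" "j' \<in> {i}" for j j' using that by simp
    show "u = v" if "j \<in> {i}" "j' \<in> {i}" "u \<in> pverts (graph_of (M j))"
      "v \<in> pverts (graph_of (M j'))" "h u = h v" for j j' u v
    proof -
      have "u = f (h u)" "v = f (h v)" using that(1-4) h(2) by simp_all
      then show ?thesis using that(5) by simp
    qed
    show "case e of (x, y) \<Rightarrow> \<exists>j\<in>{i}. \<exists>(u, v)\<in>parcs (graph_of (M j)). h u = x \<and> h v = y"
      if e: "e \<in> parcs (graph_of L)" for e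
    proof -
      obtain x y where xy: "e = (x, y)" "x \<in> pverts (graph_of L)" "y \<in> pverts (graph_of L)"
        using e arcsL by auto
      then have "(f x, f y) \<in> parcs (graph_of (M i))" using e farcs by force
      moreover have "h (f x) = x" "h (f y) = y" using xy hf by simp_all
      ultimately show ?thesis unfolding xy(1) by blast
    qed
  qed
  \<comment> \<open>If \<open>l\<close> labels no vertex, \<open>the\<close> yields an arbitrary
    value, and then the case \<open>m = l\<close> below cannot arise.\<close>
  moreover have "h ` ran (labelling (M i)) \<subseteq> insert (h (the (labelling (M i) l))) (ran (labelling L))"
  proof
    fix y assume "y \<in> h ` ran (labelling (M i))"
    then obtain m u where "labelling (M i) m = Some u" "y = h u" by (auto simp: ran_def)
    then show "y \<in> insert (h (the (labelling (M i) l))) (ran (labelling L))"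
      using lab' by (cases "m = l") auto
  qed
  ultimately show ?thesis by blast
qed

text \<open>\<open>up s\<close> maps the vertices at \<open>s\<close> into the parent node, and
  \<open>h t\<close> follows vertices up to \<open>G\<close>. These maps absorb all isomorphisms and
  quotients of the construction tree.\<close>

locale unfolded_construction_tree = branching N D + G: pair_graph G
  for N :: "'t set" and D :: "'t rel" and G :: "'a pair_pre_digraph" +
  fixes r :: 't and \<Lambda> :: "'t \<Rightarrow> 'b labelled_graph"
    and up :: "'t \<Rightarrow> 'b \<Rightarrow> 'b" and h :: "'t \<Rightarrow> 'b \<Rightarrow> 'a" and k :: nat
  assumes top: "tops N D = {r}"
    and k_labelled: "t \<in> N \<Longrightarrow> k_labelled k (\<Lambda> t)"
    and root_unlabelled: "labelling (\<Lambda> r) = Map.empty"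
    and root_bij: "bij_betw (h r) (pverts (graph_of (\<Lambda> r))) (pverts G)"
    and root_arcs: "parcs G = map_prod (h r) (h r) ` parcs (graph_of (\<Lambda> r))"
    and leaf: "t \<in> N \<Longrightarrow> {s. (t, s) \<in> D} = {} \<Longrightarrow> fully_labelled (\<Lambda> t)"
    and h_step: "(t, s) \<in> D \<Longrightarrow> h s u = h t (up s u)"
    and gluing: "t \<in> N \<Longrightarrow> {s. (t, s) \<in> D} \<noteq> {} \<Longrightarrow> gluing_maps {s. (t, s) \<in> D} (\<Lambda> t) \<Lambda> up"
    and elimination: "(t, s) \<in> D \<Longrightarrow> card {s. (t, s) \<in> D} = 1 \<Longrightarrow>
      \<exists>x. up s ` ran (labelling (\<Lambda> s)) \<subseteq> insert x (ran (labelling (\<Lambda> t)))"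
    and product: "(t, s) \<in> D \<Longrightarrow> card {s. (t, s) \<in> D} \<noteq> 1 \<Longrightarrow>
      up s ` ran (labelling (\<Lambda> s)) \<subseteq> ran (labelling (\<Lambda> t))"
begin

abbreviation vertices :: "'t \<Rightarrow> 'b set" where "vertices t \<equiv> pverts (graph_of (\<Lambda> t))"

abbreviation labelled :: "'t \<Rightarrow> 'b set" where "labelled t \<equiv> ran (labelling (\<Lambda> t))"

definition bag :: "'t \<Rightarrow> 'a set" where "bag t = h t ` labelled t"

text \<open>The nodes where \<open>x\<close> is pending form a path down from the root that ends just above the
  topmost bag containing \<open>x\<close>.\<close>

definition pending :: "'a \<Rightarrow> 't \<Rightarrow> bool" where
  "pending x t \<longleftrightarrow> t \<in> N \<and> x \<in> h t ` (vertices t - labelled t)"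

lemma labelled_subset: "t \<in> N \<Longrightarrow> labelled t \<subseteq> vertices t"
  using k_labelled by (auto simp: k_labelled_def)

lemma finite_labelled:
  assumes "t \<in> N"
  shows "finite (labelled t)"
proof (rule finite_ran, rule finite_subset)
  show "dom (labelling (\<Lambda> t)) \<subseteq> {1..k}" using k_labelled[OF assms] by (simp add: k_labelled_def)
qed simp

lemma card_labelled:
  assumes "t \<in> N"
  shows "card (labelled t) \<le> k"
proof -
  have dom: "dom (labelling (\<Lambda> t)) \<subseteq> {1..k}" using k_labelled[OF assms] by (simp add: k_labelled_def)
  have "labelled t = (\<lambda>l. the (labelling (\<Lambda> t) l)) ` dom (labelling (\<Lambda> t))"
    by (force simp: ran_def dom_def image_iff)
  then have "card (labelled t) \<le> card (dom (labelling (\<Lambda> t)))"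
    using dom by (simp add: card_image_le finite_subset)
  also have "\<dots> \<le> k" using card_mono[OF _ dom] by simp
  finally show ?thesis .
qed

lemma gluing_step: "(t, s) \<in> D \<Longrightarrow> gluing_maps {s. (t, s) \<in> D} (\<Lambda> t) \<Lambda> up"
  using gluing[of t] in_V by blast

lemma up_vertices: "(t, s) \<in> D \<Longrightarrow> u \<in> vertices s \<Longrightarrow> up s u \<in> vertices t"
  using gluing_step[of t s] unfolding gluing_maps_def by blast

lemma up_unlabelled: "(t, s) \<in> D \<Longrightarrow> u \<in> vertices s \<Longrightarrow> u \<notin> labelled s \<Longrightarrow> up s u \<notin> labelled t"
  using gluing_step[of t s] unfolding gluing_maps_def by blast

lemma up_inj:
  assumes "(t, s) \<in> D" "(t, s') \<in> D" "u \<in> vertices s" "u' \<in> vertices s'" "up s u = up s' u'"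
    "up s u \<notin> labelled t"
  shows "s = s' \<and> u = u'"
  using gluing_step[OF assms(1)] assms unfolding gluing_maps_def by blast

text \<open>Leaves are fully labelled, so a node with an unlabelled vertex has children, and gluing
  maps reach every unlabelled vertex.\<close>

lemma origin:
  assumes "t \<in> N" "w \<in> vertices t" "w \<notin> labelled t"
  shows "\<exists>s u. (t, s) \<in> D \<and> u \<in> vertices s \<and> up s u = w"
proof -
  have "{s. (t, s) \<in> D} \<noteq> {}"
    using assms leaf[of t] by (auto simp: fully_labelled_def)
  from gluing[OF assms(1) this] show ?thesis using assms unfolding gluing_maps_def by blast
qed

lemma arc_origin:
  assumes "(x, y) \<in> parcs (graph_of (\<Lambda> t))" "(t, c) \<in> D"
  shows "\<exists>s u v. (t, s) \<in> D \<and> (u, v) \<in> parcs (graph_of (\<Lambda> s)) \<and> up s u = x \<and> up s v = y"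
proof -
  have "\<forall>(x, y)\<in>parcs (graph_of (\<Lambda> t)). \<exists>s\<in>{s. (t, s) \<in> D}.
      \<exists>(u, v)\<in>parcs (graph_of (\<Lambda> s)). up s u = x \<and> up s v = y"
    using gluing_step[OF assms(2)] unfolding gluing_maps_def by (elim conjE)
  from bspec[OF this assms(1)] show ?thesis by auto
qed

lemma root_in: "r \<in> N"
  using top by (auto simp: tops_def)

lemma root_above: "t \<in> N \<Longrightarrow> (r, t) \<in> D\<^sup>*"
  using top_above[of t] top by auto

lemma has_parent: "t \<in> N \<Longrightarrow> t \<noteq> r \<Longrightarrow> \<exists>p. (p, t) \<in> D"
  using top by (auto simp: tops_def)

lemma h_vertices: "t \<in> N \<Longrightarrow> u \<in> vertices t \<Longrightarrow> h t u \<in> pverts G"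
proof -
  assume "t \<in> N" "u \<in> vertices t"
  from root_above[OF this(1)] this(2) show "h t u \<in> pverts G"
  proof (induction arbitrary: u rule: rtrancl_induct)
    case base
    then show ?case using root_bij by (auto simp: bij_betw_def)
  next
    case (step t s)
    then show ?case using h_step up_vertices by simp
  qed
qed

text \<open>On the way up an unlabelled vertex stays unlabelled, and over unlabelled vertices gluing
  is injective, so nothing is ever merged with it. The vertex \<open>w'\<close> may well be
  labelled.\<close>

lemma h_inj_unlabelled:
  assumes "t \<in> N" "w \<in> vertices t" "w \<notin> labelled t" "w' \<in> vertices t" "h t w = h t w'"
  shows "w = w'"
  using root_above[OF assms(1)] assms(2-)
proof (induction arbitrary: w w' rule: rtrancl_induct)
  case base
  then show ?case using root_bij by (auto simp: bij_betw_def dest: inj_onD)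
next
  case (step t s)
  have "up s w = up s w'"
    using step.IH[of "up s w" "up s w'"] step.prems up_vertices[OF step.hyps(2)]
      up_unlabelled[OF step.hyps(2)] h_step[OF step.hyps(2)] by simp
  then show ?case
    using up_inj[OF step.hyps(2) step.hyps(2)] up_unlabelled[OF step.hyps(2)] step.prems by blast
qed

lemma bag_not_pending: "t \<in> N \<Longrightarrow> x \<in> bag t \<Longrightarrow> \<not> pending x t"
  using h_inj_unlabelled labelled_subset by (fastforce simp: bag_def pending_def)

lemma parent_pending: "(t, s) \<in> D \<Longrightarrow> pending x s \<Longrightarrow> pending x t"
  using up_vertices up_unlabelled h_step in_V by (fastforce simp: pending_def)

lemma parent_bag_or_pending:
  assumes "(t, s) \<in> D" "x \<in> bag s"
  shows "x \<in> bag t \<or> pending x t"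
proof -
  obtain u where u: "u \<in> labelled s" "x = h s u" using assms(2) by (auto simp: bag_def)
  then have "up s u \<in> vertices t" "x = h t (up s u)"
    using up_vertices[OF assms(1)] labelled_subset[of s] h_step[OF assms(1)] in_V[OF assms(1)] by auto
  then show ?thesis using in_V[OF assms(1)] by (auto simp: bag_def pending_def)
qed

lemma child_image:
  assumes "s \<in> N" "x \<in> bag s \<or> pending x s"
  shows "x \<in> h s ` vertices s"
  using assms labelled_subset by (auto simp: bag_def pending_def)

text \<open>The preimage \<open>w\<close> of \<open>x\<close> at \<open>t\<close> is unlabelled, so
  it comes from a single vertex of a single child.\<close>

lemma pending_child_unique:
  assumes "pending x t" "(t, s) \<in> D" "(t, s') \<in> D"
    and "x \<in> bag s \<or> pending x s" "x \<in> bag s' \<or> pending x s'"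
  shows "s = s'"
proof -
  obtain w where w: "t \<in> N" "w \<in> vertices t" "w \<notin> labelled t" "h t w = x"
    using assms(1) by (auto simp: pending_def)
  obtain u where u: "u \<in> vertices s" "h s u = x"
    using child_image[of s x] assms(2,4) in_V by blast
  obtain u' where u': "u' \<in> vertices s'" "h s' u' = x"
    using child_image[of s' x] assms(3,5) in_V by blast
  have "h t w = h t (up s u)" "h t w = h t (up s' u')"
    using h_step[OF assms(2), of u] h_step[OF assms(3), of u'] u(2) u'(2) w(4) by simp_all
  then have "w = up s u" "w = up s' u'"
    using h_inj_unlabelled[OF w(1-3)] up_vertices[OF assms(2) u(1)] up_vertices[OF assms(3) u'(1)]
    by blast+
  then show ?thesis using up_inj[OF assms(2,3) u(1) u'(1)] w(3) by simp
qed

lemma pending_child: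
  assumes "pending x t"
  shows "\<exists>s. (t, s) \<in> D \<and> (x \<in> bag s \<or> pending x s)"
proof -
  obtain w where w: "t \<in> N" "w \<in> vertices t" "w \<notin> labelled t" "h t w = x"
    using assms by (auto simp: pending_def)
  then obtain s u where s: "(t, s) \<in> D" and u: "u \<in> vertices s" "up s u = w" using origin by blast
  then have "x = h s u" using w(4) h_step[OF s, of u] by simp
  then have "x \<in> bag s \<or> pending x s" using u in_V[OF s] by (auto simp: bag_def pending_def)
  then show ?thesis using s by blast
qed

lemma pending_ancestor: "(t, s) \<in> D\<^sup>* \<Longrightarrow> pending x s \<Longrightarrow> pending x t"
  by (induction rule: converse_rtrancl_induct) (auto dest: parent_pending)

text \<open>Since only one child continues the track of \<open>x\<close>, the pending nodes cannot
  branch; the induction walks down from the root to \<open>s\<close>.\<close>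

lemma pending_comparable:
  assumes "pending x t" "pending x s"
  shows "(t, s) \<in> D\<^sup>* \<or> (s, t) \<in> D\<^sup>*"
proof -
  have "s \<in> N" using assms(2) by (simp add: pending_def)
  from root_above[OF this] assms(2) show ?thesis
  proof (induction rule: rtrancl_induct)
    case base
    then show ?case using assms(1) root_above by (auto simp: pending_def)
  next
    case (step y z)
    then have "(t, y) \<in> D\<^sup>* \<or> (y, t) \<in> D\<^sup>*" using parent_pending by blast
    then show ?case
    proof
      assume "(t, y) \<in> D\<^sup>*"
      then show ?thesis using step(2) by (auto intro: rtrancl_into_rtrancl)
    next
      assume "(y, t) \<in> D\<^sup>*"
      then show ?thesis
      proof (cases rule: converse_rtranclE)
        case base
        then show ?thesis using step(2) by auto
      next
        case (step c)
        then have "pending x c" using assms(1) pending_ancestor by blast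
        then have "c = z"
          using pending_child_unique[of x y c z] step \<open>(y, z) \<in> D\<close> \<open>pending x z\<close> parent_pending by blast
        then show ?thesis using step(2) by blast
      qed
    qed
  qed
qed

lemma root_pending: "x \<in> pverts G \<Longrightarrow> pending x r"
  using root_bij root_in root_unlabelled by (auto simp: pending_def bij_betw_def)

lemma bag_root: "bag r = {}"
  by (simp add: bag_def root_unlabelled)

lemma first_bag_unique:
  assumes "(p, t) \<in> D" "(q, s) \<in> D" "pending x p" "pending x q" "x \<in> bag t" "x \<in> bag s"
  shows "t = s"
proof -
  \<comment> \<open>If \<open>p\<close> lay strictly above \<open>q\<close>, the child of
    \<open>p\<close> towards \<open>q\<close> would be pending and hence equal to \<open>t\<close>;
    but \<open>t\<close> has \<open>x\<close> in its bag and is not pending.\<close>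
  have *: "p = q" if "(p, t) \<in> D" "pending x p" "pending x q" "x \<in> bag t" "(p, q) \<in> D\<^sup>*" for p q t
    using that(5)
  proof (cases rule: converse_rtranclE)
    case (step c)
    then have "pending x c" using that pending_ancestor by blast
    moreover from this have "c = t" using pending_child_unique[of x p c t] step that by blast
    ultimately show ?thesis using that bag_not_pending in_V by blast
  qed
  have "p = q"
    using *[of p t q] *[of q s p] pending_comparable[OF assms(3,4)] assms by blast
  then show ?thesis using pending_child_unique[of x p t s] assms by blast
qed

lemma bag_connected:
  assumes x: "x \<in> pverts G"
  shows "\<exists>t0\<in>{t \<in> N. x \<in> bag t}. \<forall>t\<in>{t \<in> N. x \<in> bag t}.
    (t0, t) \<in> (D \<inter> {t \<in> N. x \<in> bag t} \<times> {t \<in> N. x \<in> bag t})\<^sup>*"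
proof -
  let ?S = "{t \<in> N. x \<in> bag t}"
  \<comment> \<open>A pending node has a child that is pending or has \<open>x\<close> in its bag;
    descents are finite, so a bag is reached.\<close>
  have "\<exists>p t. (p, t) \<in> D \<and> pending x p \<and> x \<in> bag t" if "pending x q" for q
    using that
  proof (induction q rule: wf_induct_rule[OF wf_converse])
    case (1 q)
    then show ?case using pending_child[OF 1(2)] by blast
  qed
  then obtain p0 t0 where t0: "(p0, t0) \<in> D" "pending x p0" "x \<in> bag t0"
    using root_pending[OF x] by blast
  \<comment> \<open>Climbing from \<open>t\<close>, the parent either has \<open>x\<close> in its
    bag or is pending. In the latter case \<open>t\<close> is the node where the pending path is
    left, that is \<open>t0\<close>.\<close>
  have "(t0, t) \<in> (D \<inter> ?S \<times> ?S)\<^sup>*" if "t \<in> ?S" for t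
    using that
  proof (induction t rule: wf_induct_rule[OF wf_P])
    case (1 t)
    then have "t \<noteq> r" using bag_root by auto
    then obtain p where p: "(p, t) \<in> D" using has_parent 1 by blast
    show ?case
    proof (cases "x \<in> bag p")
      case True
      then have "p \<in> ?S" using p in_V by blast
      then show ?thesis using 1 p by (meson IntI SigmaI rtrancl_into_rtrancl)
    next
      case False
      then have "pending x p" using parent_bag_or_pending[OF p] 1 by blast
      then have "t = t0" using first_bag_unique[OF p t0(1)] t0 1 by blast
      then show ?thesis by simp
    qed
  qed
  moreover have "t0 \<in> ?S" using t0 in_V by blast
  ultimately show ?thesis by blast
qed

text \<open>The arc is pulled back to a child it comes from until a leaf is reached, where both ends
  are labelled.\<close>

lemma arc_in_bag:
  assumes "(x, y) \<in> parcs G"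
  shows "\<exists>t\<in>N. x \<in> bag t \<and> y \<in> bag t"
proof -
  have *: "\<exists>s\<in>N. h t u \<in> bag s \<and> h t v \<in> bag s"
    if "t \<in> N" "(u, v) \<in> parcs (graph_of (\<Lambda> t))" for t u v
    using that
  proof (induction t arbitrary: u v rule: wf_induct_rule[OF wf_converse])
    case (1 t)
    show ?case
    proof (cases "{s. (t, s) \<in> D} = {}")
      case True
      interpret L: pair_graph "graph_of (\<Lambda> t)" using k_labelled[OF 1(2)] by (simp add: k_labelled_def)
      have "u \<in> labelled t" "v \<in> labelled t"
        using leaf[OF 1(2) True] L.in_arcsD1[OF 1(3)] L.in_arcsD2[OF 1(3)]
        by (auto simp: fully_labelled_def)
      then show ?thesis using 1(2) by (auto simp: bag_def)
    next
      case False
      then obtain s u' v' where "(t, s) \<in> D" "(u', v') \<in> parcs (graph_of (\<Lambda> s))" "up s u' = u" "up s v' = v"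
        using arc_origin[OF 1(3)] by blast
      then show ?thesis using 1(1)[of s u' v'] h_step[of t s] in_V by auto
    qed
  qed
  obtain u v where "(u, v) \<in> parcs (graph_of (\<Lambda> r))" "x = h r u" "y = h r v"
    using assms root_arcs by auto
  then show ?thesis using *[OF root_in] by blast
qed

lemma branching_decomposition_bag: "branching_decomposition G N D bag"
proof -
  have "bag t \<subseteq> pverts G" if "t \<in> N" for t
    using that h_vertices labelled_subset by (auto simp: bag_def)
  moreover have "pverts G \<subseteq> (\<Union>t\<in>N. bag t)" using bag_connected by blast
  ultimately show ?thesis
    unfolding branching_decomposition_def using bag_connected arc_in_bag by blast
qed

lemma card_bag: "t \<in> N \<Longrightarrow> card (bag t) \<le> k"
  unfolding bag_def using card_image_le[OF finite_labelled] card_labelled by (meson le_trans)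

lemma bag_step:
  assumes "(t, s) \<in> D"
  shows "\<exists>A. bag s \<subseteq> bag t \<union> A \<and> finite A \<and> card A \<le> (if card {s. (t, s) \<in> D} = 1 then 1 else 0)"
proof -
  have bag: "bag s = h t ` up s ` labelled s" using h_step[OF assms] by (auto simp: bag_def image_image)
  show ?thesis
  proof (cases "card {s. (t, s) \<in> D} = 1")
    case True
    obtain x where "up s ` labelled s \<subseteq> insert x (labelled t)" using elimination[OF assms True] by blast
    then have "bag s \<subseteq> bag t \<union> {h t x}" unfolding bag by (auto simp: bag_def)
    then show ?thesis using True by (intro exI[of _ "{h t x}"]) auto
  next
    case False
    then have "bag s \<subseteq> bag t \<union> {}" using product[OF assms] unfolding bag by (auto simp: bag_def)
    then show ?thesis using False by (intro exI[of _ "{}"]) auto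
  qed
qed

lemma card_bags_above:
  assumes "t \<in> N"
  shows "card (\<Union>s\<in>{s. (s, t) \<in> D\<^sup>*}. bag s) \<le> card {s. (s, t) \<in> D\<^sup>* \<and> card {c. (s, c) \<in> D} = 1}"
proof -
  let ?U = "\<lambda>t. \<Union>s\<in>{s. (s, t) \<in> D\<^sup>*}. bag s"
  let ?A = "\<lambda>t. {s. (s, t) \<in> D\<^sup>* \<and> card {c. (s, c) \<in> D} = 1}"
  have fin: "finite (?A t)" for t using finite_ancestors[of t] by (auto intro: finite_subset)
  \<comment> \<open>The node \<open>t\<close> is left out because, as an elimination node, it only
    enlarges the bag of its child. At the root both sides are 0, since its bag is empty.\<close>
  have "card (?U t) \<le> card (?A t - {t})"
    using root_above[OF assms]
  proof (induction rule: rtrancl_induct)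
    case base
    have "{s. (s, r) \<in> D\<^sup>*} = {r}" using top_ancestor top by auto
    then show ?case by (simp add: bag_root)
  next
    case (step t s)
    obtain A where A: "bag s \<subseteq> bag t \<union> A" "finite A"
        "card A \<le> (if card {s. (t, s) \<in> D} = 1 then 1 else 0)"
      using bag_step[OF step(2)] by blast
    have t: "t \<in> N" using step(2) in_V by blast
    have anc: "{a. (a, s) \<in> D\<^sup>*} = insert s {a. (a, t) \<in> D\<^sup>*}" using ancestors_step[OF step(2)] .
    have finU: "finite (?U t)"
      using finite_ancestors rtrancl_in_V t finite_labelled by (auto simp: bag_def)
    have "?U s \<subseteq> ?U t \<union> A" using A(1) unfolding anc by blast
    then have "card (?U s) \<le> card (?U t \<union> A)" using finU A(2) by (intro card_mono) auto
    also have "\<dots> \<le> card (?U t) + card A" by (rule card_Un_le)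
    also have "\<dots> \<le> card (?A t - {t}) + (if card {s. (t, s) \<in> D} = 1 then 1 else 0)"
      using step.IH A(3) by linarith
    also have "\<dots> \<le> card (?A t)"
    proof (cases "card {s. (t, s) \<in> D} = 1")
      case True
      then have "t \<in> ?A t" by simp
      from card.remove[OF fin this] show ?thesis using True by simp
    next
      case False
      then show ?thesis using card_mono[OF fin, of "?A t - {t}" t] by auto
    qed
    also have "?A t \<subseteq> ?A s - {s}"
    proof
      fix a assume "a \<in> ?A t"
      then show "a \<in> ?A s - {s}" using step(2) no_back[of t s] by (auto intro: rtrancl_into_rtrancl)
    qed
    then have "card (?A t) \<le> card (?A s - {s})" using fin by (intro card_mono) auto
    finally show ?case .
  qed
  also have "\<dots> \<le> card (?A t)" using fin by (intro card_mono) auto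
  finally show ?thesis .
qed

end

lemma construction_tree_imp_decomposition:
  fixes G :: "'a pair_pre_digraph" and \<Lambda> :: "'t \<Rightarrow> 'b labelled_graph"
  assumes "pair_graph G" "construction_tree k (unlabelled G) T r \<Lambda>" "elimination_depth T r \<le> q"
  shows "\<exists>(N :: 't set) D r \<beta>. branching N D \<and> tops N D = {r} \<and> branching_decomposition G N D \<beta> \<and>
       (\<forall>t\<in>N. card (\<beta> t) \<le> k) \<and> (\<forall>t\<in>N. card (\<Union>s\<in>{s. (s, t) \<in> D\<^sup>*}. \<beta> s) \<le> q)"
proof -
  define N where "N = pverts T"
  have "rooted_tree T r" using assms(2) by (simp add: construction_tree_def)
  then obtain D where D: "branching N D" "T = branching_graph N D" "tops N D = {r}"
    unfolding N_def by (rule rooted_tree_branching)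
  interpret branching N D by (rule D(1))
  note ct = assms(2)[unfolded D(2) construction_tree_iff[OF D(3)]]
  note depth = assms(3)[unfolded D(2) elimination_depth_le_iff[OF D(3)]]
  let ?C = "\<lambda>t. {s. (t, s) \<in> D}"
  have kl: "k_labelled k (\<Lambda> t)" if "t \<in> N" for t using ct that by blast
  have ran: "ran (labelling (\<Lambda> t)) \<subseteq> pverts (graph_of (\<Lambda> t))" if "t \<in> N" for t
    using kl[OF that] by (simp add: k_labelled_def)
  have arcs: "parcs (graph_of (\<Lambda> t)) \<subseteq> pverts (graph_of (\<Lambda> t)) \<times> pverts (graph_of (\<Lambda> t))"
    if "t \<in> N" for t
  proof -
    interpret L: pair_graph "graph_of (\<Lambda> t)" using kl[OF that] by (simp add: k_labelled_def)
    show ?thesis using L.in_arcsD1 L.in_arcsD2 by auto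
  qed
  let ?ok = "\<lambda>t g. ?C t \<noteq> {} \<longrightarrow> gluing_maps (?C t) (\<Lambda> t) \<Lambda> g \<and>
      (card (?C t) = 1 \<longrightarrow> (\<forall>s\<in>?C t. \<exists>x. g s ` ran (labelling (\<Lambda> s)) \<subseteq> insert x (ran (labelling (\<Lambda> t))))) \<and>
      (card (?C t) \<noteq> 1 \<longrightarrow> (\<forall>s\<in>?C t. g s ` ran (labelling (\<Lambda> s)) \<subseteq> ran (labelling (\<Lambda> t))))"
  have "\<forall>t\<in>N. \<exists>g. ?ok t g"
  proof
    fix t assume t: "t \<in> N"
    have fin: "finite (?C t)" by (rule finite_subset[OF _ finite_V]) (auto dest: in_V)
    have ranC: "ran (labelling (\<Lambda> s)) \<subseteq> pverts (graph_of (\<Lambda> s))" if "s \<in> ?C t" for s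
      using that ran in_V by blast
    have "?C t = {} \<or> card (?C t) = 1 \<or> card (?C t) > 1"
      using card_0_eq[OF fin] by linarith
    then consider "?C t = {}" | s where "?C t = {s}" | "card (?C t) > 1"
      by (elim disjE card_1_singletonE)
    then show "\<exists>g. ?ok t g"
    proof cases
      case (2 s)
      then obtain l where "labelled_iso (\<Lambda> t) (remove_label l (\<Lambda> s))" using ct t by blast
      moreover have "ran (labelling (\<Lambda> s)) \<subseteq> pverts (graph_of (\<Lambda> s))" using ranC 2 by blast
      ultimately obtain g x where "gluing_maps {s} (\<Lambda> t) \<Lambda> g"
        "g s ` ran (labelling (\<Lambda> s)) \<subseteq> insert x (ran (labelling (\<Lambda> t)))"
        using elimination_gluing_maps[of "\<Lambda> t" l \<Lambda> s] ran[OF t] arcs[OF t] by blast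
      then show ?thesis unfolding 2 by (intro exI[of _ g]) auto
    next
      case 3
      then have "labelled_iso (\<Lambda> t) (labelled_product (?C t) \<Lambda>)" using ct t by blast
      from product_gluing_maps[OF this ran[OF t] arcs[OF t] ranC] obtain g where
        "gluing_maps (?C t) (\<Lambda> t) \<Lambda> g"
        "\<forall>i\<in>?C t. g i ` ran (labelling (\<Lambda> i)) \<subseteq> ran (labelling (\<Lambda> t))" by blast
      then show ?thesis using 3 by (intro exI[of _ g]) auto
    qed simp
  qed
  from bchoice[OF this] obtain \<gamma> where \<gamma>: "\<forall>t\<in>N. ?ok t (\<gamma> t)" ..
  \<comment> \<open>The map \<gamma> chooses, at every node, gluing maps for all of its children at
    once; \<open>up s\<close> takes the one chosen at the parent of \<open>s\<close>.\<close>
  define up where "up s = \<gamma> (THE t. (t, s) \<in> D) s" for s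
  have up: "up s = \<gamma> t s" if "(t, s) \<in> D" for t s
  proof -
    have "(THE t. (t, s) \<in> D) = t" using that parent_unique by (intro the_equality) auto
    then show ?thesis by (simp add: up_def)
  qed
  obtain f where f: "bij_betw f (pverts (graph_of (\<Lambda> r))) (pverts G)"
      "parcs G = map_prod f f ` parcs (graph_of (\<Lambda> r))" "\<And>l. map_option f (labelling (\<Lambda> r) l) = None"
    using ct unfolding labelled_iso_def unlabelled_def by (auto simp: fun_eq_iff)
  obtain h where h: "h r = f" "\<forall>(t, s)\<in>D. \<forall>u. h s u = h t (up s u)"
    using path_composition[OF D(3)] by blast
  interpret unfolded_construction_tree N D G r \<Lambda> up h k
  proof (intro unfolded_construction_tree.intro unfolded_construction_tree_axioms.intro)
    show "gluing_maps (?C t) (\<Lambda> t) \<Lambda> up" if "t \<in> N" "?C t \<noteq> {}" for t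
    proof -
      have "gluing_maps (?C t) (\<Lambda> t) \<Lambda> (\<gamma> t)" using \<gamma> that by blast
      then show ?thesis unfolding gluing_maps_def using up by simp
    qed
    show "\<exists>x. up s ` ran (labelling (\<Lambda> s)) \<subseteq> insert x (ran (labelling (\<Lambda> t)))"
      if "(t, s) \<in> D" "card (?C t) = 1" for t s
      using \<gamma> that in_V unfolding up[OF that(1)] by blast
    show "up s ` ran (labelling (\<Lambda> s)) \<subseteq> ran (labelling (\<Lambda> t))"
      if "(t, s) \<in> D" "card (?C t) \<noteq> 1" for t s
      using \<gamma> that in_V unfolding up[OF that(1)] by blast
    show "labelling (\<Lambda> r) = Map.empty" using f(3) by (auto simp: fun_eq_iff)
    show "branching N D" by (rule D(1))
    show "pair_graph G" by (rule assms(1))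
    show "tops N D = {r}" by (rule D(3))
    show "fully_labelled (\<Lambda> t)" if "t \<in> N" "?C t = {}" for t using ct that by blast
    show "h s u = h t (up s u)" if "(t, s) \<in> D" for t s u using h(2) that by blast
  qed (use f h kl in auto)
  have "card (\<Union>s\<in>{s. (s, t) \<in> D\<^sup>*}. bag s) \<le> q" if "t \<in> N" for t
    using card_bags_above[OF that] depth that by (meson le_trans)
  then show ?thesis using D branching_decomposition_bag card_bag by blast
qed

theorem theorem3p4:
  fixes G :: "'a pair_pre_digraph" and k q :: nat
  assumes "k \<ge> 1" and "q \<ge> 1" and "pair_graph G"
  shows
    "((\<exists>(T :: nat pair_pre_digraph) r (\<Lambda> :: nat \<Rightarrow> nat labelled_graph).
         construction_tree k (unlabelled G) T r \<Lambda> \<and> elimination_depth T r \<le> q)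
      \<longleftrightarrow>
      (\<exists>(T :: nat pair_pre_digraph) \<beta>.
         tree_decomposition G T \<beta> \<and> td_width T \<beta> \<le> int k - 1 \<and> td_depth T \<beta> \<le> q))
     \<and>
     ((\<exists>(T :: nat pair_pre_digraph) \<beta>.
         tree_decomposition G T \<beta> \<and> td_width T \<beta> \<le> int k - 1 \<and> td_depth T \<beta> \<le> q)
      \<longleftrightarrow>
      (\<exists>F R p. pebble_forest_cover k G F R p \<and> forest_depth F R \<le> q))"
  (is "(?construction \<longleftrightarrow> ?decomposition) \<and> (?decomposition \<longleftrightarrow> ?cover)")
proof -
  \<comment> \<open>The decomposition reuses the nodes of the construction tree, so natural numbers
    serve as nodes for both.\<close>
  note decomposition = tree_decomposition_iff_branching[OF assms(3), where ?'t = nat]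
  note cover = pebble_forest_cover_iff_branching[OF assms(3)]
  have "?decomposition" if ?construction
  proof -
    obtain T :: "nat pair_pre_digraph" and r and \<Lambda> :: "nat \<Rightarrow> nat labelled_graph"
      where "construction_tree k (unlabelled G) T r \<Lambda>" "elimination_depth T r \<le> q"
      using \<open>?construction\<close> by blast
    then show ?thesis
      unfolding decomposition by (rule construction_tree_imp_decomposition[OF assms(3)])
  qed
  moreover have "?cover" if ?decomposition
    using that branching_decomposition_imp_pebbling[OF assms(3)] unfolding decomposition cover by blast
  moreover have "?construction" if ?cover
    using that pebbling_imp_construction_tree[OF assms(3)] unfolding cover by blast
  ultimately show ?thesis by blast
qed

end
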